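(* Let $K$ be a field, $n\ge 2$ a positive integer, and $R_n$ the rose with $n$ petals. Then the following set $$\{V_{[\alpha]}\mid \alpha\in (R_n)^{\infty}_{irr}\} \sqcup \{S^f_{\Pi_c}\mid c\in SCP(R_n),\, f \in \mathrm{Irr}(K[x])\}\sqcup \{S^{f,\, p}_{d} \mid d\in C_s(R_n),\, f \in \mathrm{Irr}(K[x]),\, [0]\neq [p]\in A_{R_n}(e_1, e_2)/\!\equiv_{f, d}\}$$ consists of pairwise non-isomorphic simple left $L_K(R_n)$-modules. (Here the first family is indexed by the tail-equivalence classes $[\alpha]$, the second by the pairs $(f,\Pi_c)$, and the third by the triples $(f,d,[p])$, with one representative $p$ for each class $[p]$.)
   Context: $R_n$ is the directed graph with one vertex $v$ and $n$ loops $e_1,\ldots,e_n$. Its Leavitt path algebra $L_K(R_n)$ is the unital associative $K$-algebra generated by $v,e_1,\ldots,e_n,e_1^*,\ldots,e_n^*$ subject to $v=1$, $e_i^*e_j=\delta_{i,j}v$ for all $1\le i,j\le n$, and $\sum_{i=1}^n e_ie_i^*=v$. Infinite paths: $(R_n)^\infty$ is the set of infinite sequences $e_{k_1}e_{k_2}\cdots$ of edges. For $\alpha=e_{k_1}e_{k_2}\cdots$ put $\tau_{>m}(\alpha)=e_{k_{m+1}}e_{k_{m+2}}\cdots$. Two infinite paths $\alpha,\beta$ are tail-equivalent ($\alpha\sim\beta$) if $\tau_{>m}(\alpha)=\tau_{>l}(\beta)$ for some positive integers $m,l$; $[\alpha]$ is the class of $\alpha$. A closed path is a nonempty word in the edges;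 for a closed path $c$, $c^\infty=ccc\cdots$. An infinite path is rational if it is tail-equivalent to $c^\infty$ for some closed path $c$, and irrational otherwise; $(R_n)^\infty_{irr}$ is the set of irrational infinite paths. $V_{[\alpha]}$ is the $K$-vector space with basis $\{\beta\in (R_n)^\infty\mid\beta\in[\alpha]\}$, made a left $L_K(R_n)$-module by $v\cdot\beta=\beta$, $e_i\cdot\beta=e_i\beta$, and $e_i^*\cdot\beta=\tau_{>1}(\beta)$ if $\beta=e_i\tau_{>1}(\beta)$ and $0$ otherwise. A closed path is simple if it is not of the form $d^k$ with $d$ a closed path and $k\ge2$; $SCP(R_n)$ is the set of simple closed paths. For $c=e_{k_1}\cdots e_{k_m}\in SCP(R_n)$, $\Pi_c$ is the set of all cyclic rotations $e_{k_i}\cdots e_{k_m}e_{k_1}\cdots e_{k_{i-1}}$ of $c$. $C_s(R_n)$ is the set of simple closed paths $e_{k_1}\cdots e_{k_m}$ ($m\ge1$) with $k_i\in\{1,3,\ldots,n\}$ for $1\le i\le m-1$ and $k_m=2$. $\mathrm{Irr}(K[x])$ is the set of irreducible polynomials in $K[x]$ of the form $f(x)=1-a_1x-\cdots-a_sx^s$, and $f(c)=v-a_1c-\cdots-a_sc^s\in L_K(R_n)$. For $c\in SCP(R_n)$ and such $f$, $S^f_c$ is the cyclic left $L_K(R_n)$-module generated by $z$ subject to $z=(a_1c+\cdots+a_sc^s)z$; equivalently $S^f_c\cong L_K(R_n)/L_K(R_n)f(c)$. It is known that $S^f_d\cong S^f_c$ if and only if $d\in\Pi_c$; $S^f_{\Pi_c}$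 denotes a module representing this common isomorphism class. $A_{R_n}(e_1,e_2)$ is the $K$-subalgebra of $L_K(R_n)$ generated by $v,e_1,e_3,\ldots,e_n,e_2^*,\ldots,e_n^*$. For $p\in A_{R_n}(e_1,e_2)$, $\sigma_p$ is the unique $K$-algebra automorphism of $L_K(R_n)$ with $\sigma_p(e_2)=e_2+e_1p$, $\sigma_p(e_1^* )=e_1^*-pe_2^*$, and $\sigma_p(a)=a$ for all $a\in A_{R_n}(e_1,e_2)$. For $d\in C_s(R_n)$, $S^{f,\,p}_d$ is the twisted module $(S^f_d)^{\sigma_p}$: the same abelian group as $S^f_d$ with action $r\ast y=\sigma_p(r)y$. For $(f,d)\in\mathrm{Irr}(K[x])\times C_s(R_n)$, the equivalence relation $\equiv_{f,d}$ on $A_{R_n}(e_1,e_2)$ is defined by $p\equiv_{f,d}q$ if and only if $p-q=rf(d)$ for some $r\in L_K(R_n)$; $[p]$ is the class of $p$. *)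

theory Defs
  imports
    "HOL-Library.Poly_Mapping"
    "HOL-Library.Stream"
    "HOL-Library.Cardinality"
    "HOL-Computational_Algebra.Polynomial_Factorial"
begin

section \<open>The Leavitt path algebra of a rose\<close>

text \<open>
  The petals of the rose are indexed by a finite type \<open>'n\<close>, so that \<open>n = CARD('n)\<close>.  The
  generator \<open>v\<close> is omitted, since the relation \<open>v = 1\<close> identifies it with the unit.
\<close>

datatype 'n gen = Edge 'n | Ghost 'n

text \<open>
  Words form a monoid under concatenation; with this instance the ring \<open>'n gen list \<Rightarrow>\<^sub>0 'k\<close> of
  finitely supported functions under convolution is the free unital \<open>'k\<close>-algebra on \<open>'n gen\<close>.
\<close>

instantiation list :: (type) monoid_add
begin

definition zero_list :: "'a list" where "0 = ([] :: 'a list)"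
definition plus_list :: "'a list \<Rightarrow> 'a list \<Rightarrow> 'a list" where "xs + ys = xs @ ys"

instance by standard (simp_all add: zero_list_def plus_list_def)

end

type_synonym ('k, 'n) free_alg = "'n gen list \<Rightarrow>\<^sub>0 'k"

definition free_gen :: "'n gen \<Rightarrow> ('k::field, 'n) free_alg" where
  "free_gen g = Poly_Mapping.single [g] 1"

definition lpa_relators :: "('k::field, 'n::finite) free_alg set" where
  "lpa_relators =
     {free_gen (Ghost i) * free_gen (Edge j) - (if i = j then 1 else 0) | i j. True}
     \<union> {(\<Sum>i\<in>UNIV. free_gen (Edge i) * free_gen (Ghost i)) - 1}"

text \<open>The two-sided ideal generated by the relators.\<close>

inductive_set lpa_ideal :: "('k::field, 'n::finite) free_alg set" where
  zero: "0 \<in> lpa_ideal"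
| rel: "r \<in> lpa_relators \<Longrightarrow> x * r * y \<in> lpa_ideal"
| add: "a \<in> lpa_ideal \<Longrightarrow> b \<in> lpa_ideal \<Longrightarrow> a + b \<in> lpa_ideal"

lemma lpa_ideal_mult_left: "a \<in> lpa_ideal \<Longrightarrow> z * a \<in> lpa_ideal"
proof (induction rule: lpa_ideal.induct)
  case (rel r x y)
  then show ?case using lpa_ideal.rel[of r "z * x" y] by (simp add: mult.assoc)
qed (auto intro: lpa_ideal.intros simp: distrib_left)

lemma lpa_ideal_mult_right: "a \<in> lpa_ideal \<Longrightarrow> a * z \<in> lpa_ideal"
proof (induction rule: lpa_ideal.induct)
  case (rel r x y)
  then show ?case using lpa_ideal.rel[of r x "y * z"] by (simp add: mult.assoc)
qed (auto intro: lpa_ideal.intros simp: distrib_right)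

lemma lpa_ideal_uminus: "a \<in> lpa_ideal \<Longrightarrow> - a \<in> lpa_ideal"
  using lpa_ideal_mult_left[of a "- 1"] by simp

lemma lpa_ideal_diff: "a \<in> lpa_ideal \<Longrightarrow> b \<in> lpa_ideal \<Longrightarrow> a - b \<in> lpa_ideal"
  using lpa_ideal.add[of a "- b"] lpa_ideal_uminus[of b] by simp

definition lpa_rel :: "('k::field, 'n::finite) free_alg \<Rightarrow> ('k, 'n) free_alg \<Rightarrow> bool" where
  "lpa_rel x y \<longleftrightarrow> x - y \<in> lpa_ideal"

lemma equivp_lpa_rel: "equivp (lpa_rel :: ('k::field, 'n::finite) free_alg \<Rightarrow> _)"
proof (rule equivpI)
  show "reflp (lpa_rel :: ('k, 'n) free_alg \<Rightarrow> _)" by (auto intro!: reflpI simp: lpa_rel_def lpa_ideal.zero)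
  show "symp (lpa_rel :: ('k, 'n) free_alg \<Rightarrow> _)"
  proof (rule sympI)
    fix x y :: "('k, 'n) free_alg" assume "lpa_rel x y"
    then show "lpa_rel y x" using lpa_ideal_uminus[of "x - y"] by (simp add: lpa_rel_def)
  qed
  show "transp (lpa_rel :: ('k, 'n) free_alg \<Rightarrow> _)"
  proof (rule transpI)
    fix x y z :: "('k, 'n) free_alg" assume "lpa_rel x y" "lpa_rel y z"
    then show "lpa_rel x z" using lpa_ideal.add[of "x - y" "y - z"] by (simp add: lpa_rel_def)
  qed
qed

subsection \<open>The action of the free algebra on infinite paths\<close>

text \<open>
  Infinite paths are streams of petals, and \<open>'n stream \<Rightarrow>\<^sub>0 'k\<close> is the vector space with basis all
  infinite paths.  The action is set up before the quotient is formed because it also shows that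
  the Leavitt path algebra is not the zero ring.
\<close>

definition vscale :: "'k::field \<Rightarrow> ('b \<Rightarrow>\<^sub>0 'k) \<Rightarrow> ('b \<Rightarrow>\<^sub>0 'k)" where
  "vscale a \<phi> = Poly_Mapping.map ((*) a) \<phi>"

definition lin_ext :: "('b \<Rightarrow> ('c \<Rightarrow>\<^sub>0 'k::field)) \<Rightarrow> ('b \<Rightarrow>\<^sub>0 'k) \<Rightarrow> ('c \<Rightarrow>\<^sub>0 'k)" where
  "lin_ext f \<phi> = (\<Sum>b\<in>Poly_Mapping.keys \<phi>. vscale (Poly_Mapping.lookup \<phi> b) (f b))"

fun gen_on_path :: "'n gen \<Rightarrow> 'n stream \<Rightarrow> ('n stream \<Rightarrow>\<^sub>0 'k::field)" where
  "gen_on_path (Edge i) \<beta> = Poly_Mapping.single (i ## \<beta>) 1"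
| "gen_on_path (Ghost i) \<beta> = (if shd \<beta> = i then Poly_Mapping.single (stl \<beta>) 1 else 0)"

definition gen_act :: "'n gen \<Rightarrow> ('n stream \<Rightarrow>\<^sub>0 'k::field) \<Rightarrow> ('n stream \<Rightarrow>\<^sub>0 'k)" where
  "gen_act g = lin_ext (gen_on_path g)"

definition word_act :: "'n gen list \<Rightarrow> ('n stream \<Rightarrow>\<^sub>0 'k::field) \<Rightarrow> ('n stream \<Rightarrow>\<^sub>0 'k)" where
  "word_act w = foldr gen_act w"

definition free_act ::
  "('k::field, 'n) free_alg \<Rightarrow> ('n stream \<Rightarrow>\<^sub>0 'k) \<Rightarrow> ('n stream \<Rightarrow>\<^sub>0 'k)" where
  "free_act x \<phi> = lin_ext (\<lambda>w. word_act w \<phi>) x"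

lemma lookup_vscale [simp]:
  "Poly_Mapping.lookup (vscale a \<phi>) b = a * Poly_Mapping.lookup \<phi> b"
  by (simp add: vscale_def Poly_Mapping.map.rep_eq when_def)

lemma vscale_add: "vscale a (\<phi> + \<psi>) = vscale a \<phi> + vscale a \<psi>"
  by (rule poly_mapping_eqI) (simp add: lookup_add algebra_simps)

lemma vscale_add_left: "vscale (a + b) \<phi> = vscale a \<phi> + vscale b \<phi>"
  by (rule poly_mapping_eqI) (simp add: lookup_add algebra_simps)

lemma vscale_zero [simp]: "vscale a 0 = 0" "vscale 0 \<phi> = 0"
  by (rule poly_mapping_eqI; simp)+

lemma vscale_one [simp]: "vscale 1 \<phi> = \<phi>"
  by (rule poly_mapping_eqI) simp

lemma vscale_vscale: "vscale a (vscale b \<phi>) = vscale (a * b) \<phi>"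
  by (rule poly_mapping_eqI) (simp add: mult.assoc)

lemma vscale_single: "vscale a (Poly_Mapping.single b c) = Poly_Mapping.single b (a * c)"
  by (rule poly_mapping_eqI) (simp add: lookup_single when_def)

lemma vscale_sum: "vscale a (sum f A) = (\<Sum>x\<in>A. vscale a (f x))"
  by (induction A rule: infinite_finite_induct) (simp_all add: vscale_add)

lemma lin_ext_superset:
  assumes "finite A" "Poly_Mapping.keys \<phi> \<subseteq> A"
  shows "lin_ext f \<phi> = (\<Sum>b\<in>A. vscale (Poly_Mapping.lookup \<phi> b) (f b))"
  unfolding lin_ext_def using assms
  by (intro sum.mono_neutral_left) (auto simp: in_keys_iff)

lemma lin_ext_add: "lin_ext f (\<phi> + \<psi>) = lin_ext f \<phi> + lin_ext f \<psi>"
proof -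
  let ?A = "Poly_Mapping.keys \<phi> \<union> Poly_Mapping.keys \<psi>"
  have "finite ?A" "Poly_Mapping.keys (\<phi> + \<psi>) \<subseteq> ?A"
    using keys_add[of \<phi> \<psi>] by auto
  then show ?thesis
    by (simp add: lin_ext_superset[of ?A] lookup_add vscale_add_left sum.distrib)
qed

lemma lin_ext_single [simp]: "lin_ext f (Poly_Mapping.single b c) = vscale c (f b)"
  by (subst lin_ext_superset[of "{b}"]) (auto simp: lookup_single)

lemma lin_ext_zero [simp]: "lin_ext f 0 = 0"
  by (simp add: lin_ext_def)

lemma lin_ext_fun_add: "lin_ext (\<lambda>b. f b + g b) \<phi> = lin_ext f \<phi> + lin_ext g \<phi>"
  by (simp add: lin_ext_def vscale_add sum.distrib)

lemma lin_ext_fun_zero [simp]: "lin_ext (\<lambda>b. 0) \<phi> = 0"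
  by (simp add: lin_ext_def)

lemma lin_ext_vscale: "lin_ext f (vscale a \<phi>) = vscale a (lin_ext f \<phi>)"
  by (subst lin_ext_superset[of "Poly_Mapping.keys \<phi>"])
     (auto simp: in_keys_iff lin_ext_def vscale_sum vscale_vscale)

lemma lin_ext_fun_vscale: "lin_ext (\<lambda>b. vscale a (f b)) \<phi> = vscale a (lin_ext f \<phi>)"
  by (simp add: lin_ext_def vscale_sum vscale_vscale mult.commute)

lemma single_induct [case_names zero single add]:
  fixes x :: "'b \<Rightarrow>\<^sub>0 'k::comm_monoid_add"
  assumes "P 0" "\<And>b c. P (Poly_Mapping.single b c)" "\<And>x y. P x \<Longrightarrow> P y \<Longrightarrow> P (x + y)"
  shows "P x"
proof -
  have "x = (\<Sum>b\<in>Poly_Mapping.keys x. Poly_Mapping.single b (Poly_Mapping.lookup x b))"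
  proof (rule poly_mapping_eqI)
    fix k
    have "Poly_Mapping.lookup (\<Sum>b\<in>A. Poly_Mapping.single b (Poly_Mapping.lookup x b)) k =
        (if k \<in> A then Poly_Mapping.lookup x k else 0)" if "finite A" for A
      using that by (induction A) (auto simp: lookup_add lookup_single when_def)
    then show "Poly_Mapping.lookup x k = Poly_Mapping.lookup
        (\<Sum>b\<in>Poly_Mapping.keys x. Poly_Mapping.single b (Poly_Mapping.lookup x b)) k"
      by (simp add: in_keys_iff)
  qed
  moreover have "P (\<Sum>b\<in>A. Poly_Mapping.single b (Poly_Mapping.lookup x b))" for A
    by (induction A rule: infinite_finite_induct) (auto intro: assms)
  ultimately show ?thesis by metis
qed

lemma word_act_Nil [simp]: "word_act [] \<phi> = \<phi>"
  and word_act_Cons [simp]: "word_act (g # w) \<phi> = gen_act g (word_act w \<phi>)"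
  and word_act_append: "word_act (u @ w) \<phi> = word_act u (word_act w \<phi>)"
  by (simp_all add: word_act_def)

lemma word_act_add: "word_act w (\<phi> + \<psi>) = word_act w \<phi> + word_act w \<psi>"
  by (induction w) (simp_all add: gen_act_def lin_ext_add)

lemma word_act_vscale: "word_act w (vscale a \<phi>) = vscale a (word_act w \<phi>)"
  by (induction w) (simp_all add: gen_act_def lin_ext_vscale)

lemma word_act_zero [simp]: "word_act w 0 = 0"
  using word_act_vscale[of w 0 0] by simp

lemma free_act_add_left: "free_act (x + y) \<phi> = free_act x \<phi> + free_act y \<phi>"
  by (simp add: free_act_def lin_ext_add)

lemma free_act_add_right: "free_act x (\<phi> + \<psi>) = free_act x \<phi> + free_act x \<psi>"
  by (simp add: free_act_def word_act_add lin_ext_fun_add)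

lemma free_act_vscale: "free_act x (vscale a \<phi>) = vscale a (free_act x \<phi>)"
  by (simp add: free_act_def word_act_vscale lin_ext_fun_vscale)

lemma free_act_zero [simp]: "free_act 0 \<phi> = 0" "free_act x 0 = 0"
  by (simp_all add: free_act_def)

lemma free_act_single: "free_act (Poly_Mapping.single w a) \<phi> = vscale a (word_act w \<phi>)"
  by (simp add: free_act_def)

lemma free_act_one [simp]: "free_act 1 \<phi> = \<phi>"
  by (simp add: free_act_single zero_list_def flip: single_one)

lemma free_act_mult: "free_act (x * y) \<phi> = free_act x (free_act y \<phi>)"
proof (induction x rule: single_induct)
  case (single u a)
  show ?case
  proof (induction y rule: single_induct)
    case (single w b)
    show ?case
      by (simp add: mult_single free_act_single plus_list_def word_act_append word_act_vscale
          vscale_vscale)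
  qed (simp_all add: distrib_left free_act_add_left free_act_add_right)
qed (simp_all add: distrib_right free_act_add_left)

lemma free_act_diff: "free_act (x - y) \<phi> = free_act x \<phi> - free_act y \<phi>"
  using free_act_add_left[of "x - y" y \<phi>] by simp

lemma free_act_sum: "free_act (sum f A) \<phi> = (\<Sum>a\<in>A. free_act (f a) \<phi>)"
  by (induction A rule: infinite_finite_induct) (simp_all add: free_act_add_left)

lemma free_act_gen: "free_act (free_gen g) \<phi> = gen_act g \<phi>"
  by (simp add: free_gen_def free_act_single)

lemma free_act_relator:
  fixes r :: "('k::field, 'n::finite) free_alg"
  assumes "r \<in> lpa_relators"
  shows "free_act r \<phi> = 0"
proof (induction \<phi> rule: single_induct)
  case (single \<beta> c)
  have 1: "gen_act (Ghost i) (gen_act (Edge j) (Poly_Mapping.single \<beta> c)) =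
      (if i = j then Poly_Mapping.single \<beta> c else 0)" for i j :: 'n
    by (auto simp: gen_act_def vscale_single)
  have "gen_act (Edge i) (gen_act (Ghost i) (Poly_Mapping.single \<beta> c)) =
      (if i = shd \<beta> then Poly_Mapping.single \<beta> c else 0)" for i :: 'n
    by (auto simp: gen_act_def vscale_single)
  then have "(\<Sum>i\<in>UNIV. gen_act (Edge i) (gen_act (Ghost i) (Poly_Mapping.single \<beta> c))) =
      Poly_Mapping.single \<beta> c"
    by simp
  with 1 assms show ?case
    by (auto simp: lpa_relators_def free_act_diff free_act_sum free_act_mult free_act_gen)
qed (simp_all add: free_act_add_right)

lemma free_act_ideal: "r \<in> lpa_ideal \<Longrightarrow> free_act r \<phi> = 0"
  by (induction arbitrary: \<phi> rule: lpa_ideal.induct)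
     (simp_all add: free_act_add_left free_act_mult free_act_relator)

subsection \<open>The quotient algebra\<close>

quotient_type (overloaded) ('k, 'n) lpa = "('k::field, 'n::finite) free_alg" / lpa_rel
  by (rule equivp_lpa_rel)

instantiation lpa :: (field, finite) ring_1
begin

lift_definition zero_lpa :: "('a, 'b) lpa" is 0 .
lift_definition one_lpa :: "('a, 'b) lpa" is 1 .

lift_definition plus_lpa :: "('a, 'b) lpa \<Rightarrow> ('a, 'b) lpa \<Rightarrow> ('a, 'b) lpa" is "(+)"
proof -
  fix x x' y y' :: "('a, 'b) free_alg"
  assume "lpa_rel x x'" "lpa_rel y y'"
  then have "(x - x') + (y - y') \<in> lpa_ideal"
    by (auto simp: lpa_rel_def intro: lpa_ideal.add)
  then show "lpa_rel (x + y) (x' + y')" by (simp add: lpa_rel_def algebra_simps)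
qed

lift_definition uminus_lpa :: "('a, 'b) lpa \<Rightarrow> ('a, 'b) lpa" is uminus
proof -
  fix x x' :: "('a, 'b) free_alg"
  assume "lpa_rel x x'"
  then have "- (x - x') \<in> lpa_ideal"
    unfolding lpa_rel_def by (rule lpa_ideal_uminus)
  then show "lpa_rel (- x) (- x')" by (simp add: lpa_rel_def)
qed

lift_definition minus_lpa :: "('a, 'b) lpa \<Rightarrow> ('a, 'b) lpa \<Rightarrow> ('a, 'b) lpa" is "(-)"
proof -
  fix x x' y y' :: "('a, 'b) free_alg"
  assume "lpa_rel x x'" "lpa_rel y y'"
  then have "(x - x') - (y - y') \<in> lpa_ideal"
    unfolding lpa_rel_def by (rule lpa_ideal_diff)
  then show "lpa_rel (x - y) (x' - y')" by (simp add: lpa_rel_def algebra_simps)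
qed

lift_definition times_lpa :: "('a, 'b) lpa \<Rightarrow> ('a, 'b) lpa \<Rightarrow> ('a, 'b) lpa" is "(*)"
proof -
  fix x x' y y' :: "('a, 'b) free_alg"
  assume "lpa_rel x x'" "lpa_rel y y'"
  then have "(x - x') * y + x' * (y - y') \<in> lpa_ideal"
    by (auto simp: lpa_rel_def intro: lpa_ideal.add lpa_ideal_mult_left lpa_ideal_mult_right)
  then show "lpa_rel (x * y) (x' * y')" by (simp add: lpa_rel_def algebra_simps)
qed

instance
proof
  show "(0 :: ('a, 'b) lpa) \<noteq> 1"
  proof transfer
    have "free_act (0 - 1 :: ('a, 'b) free_alg) (Poly_Mapping.single (sconst undefined) 1) =
        - Poly_Mapping.single (sconst undefined) 1"
      by (subst free_act_diff) simp
    also have "\<dots> \<noteq> 0"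
      by (metis lookup_single_eq neg_equal_0_iff_equal lookup_zero zero_neq_one)
    finally have "free_act (0 - 1 :: ('a, 'b) free_alg)
        (Poly_Mapping.single (sconst undefined) 1) \<noteq> 0" .
    then show "\<not> lpa_rel 0 (1 :: ('a, 'b) free_alg)"
      using free_act_ideal unfolding lpa_rel_def by blast
  qed
qed (transfer; simp add: lpa_rel_def lpa_ideal.zero algebra_simps)+

end

lift_definition lpa_scalar :: "'k::field \<Rightarrow> ('k, 'n::finite) lpa" is "Poly_Mapping.single []" .

lift_definition edge :: "'n::finite \<Rightarrow> ('k::field, 'n) lpa" is "\<lambda>i. free_gen (Edge i)" .

lift_definition ghost :: "'n::finite \<Rightarrow> ('k::field, 'n) lpa" is "\<lambda>i. free_gen (Ghost i)" .

lift_definition path_act ::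
  "('k::field, 'n::finite) lpa \<Rightarrow> ('n stream \<Rightarrow>\<^sub>0 'k) \<Rightarrow> ('n stream \<Rightarrow>\<^sub>0 'k)" is free_act
proof (rule ext)
  fix x y :: "('k, 'n) free_alg" and \<phi> :: "'n stream \<Rightarrow>\<^sub>0 'k"
  assume "lpa_rel x y"
  then have "free_act (x - y) \<phi> = 0"
    unfolding lpa_rel_def by (rule free_act_ideal)
  then show "free_act x \<phi> = free_act y \<phi>" by (simp add: free_act_diff)
qed

lemma ghost_edge: "ghost i * edge j = (if i = j then 1 else 0 :: ('k::field, 'n::finite) lpa)"
proof -
  let ?r = "free_gen (Ghost i) * free_gen (Edge j) - (if i = j then 1 else 0 :: ('k, 'n) free_alg)"
  have "?r \<in> lpa_relators"
    unfolding lpa_relators_def by blast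
  then have "1 * ?r * 1 \<in> lpa_ideal"
    by (rule lpa_ideal.rel)
  then have "lpa_rel (free_gen (Ghost i) * free_gen (Edge j))
      (if i = j then 1 else 0 :: ('k, 'n) free_alg)"
    by (simp add: lpa_rel_def)
  then show ?thesis
    by (auto simp: edge_def ghost_def times_lpa.abs_eq one_lpa_def zero_lpa_def lpa.abs_eq_iff)
qed

lemma abs_lpa_sum: "abs_lpa (sum f A) = (\<Sum>a\<in>A. abs_lpa (f a))"
  by (induction A rule: infinite_finite_induct) (simp_all add: zero_lpa_def flip: plus_lpa.abs_eq)

lemma edge_ghost_sum: "(\<Sum>i\<in>UNIV. edge i * ghost i) = (1 :: ('k::field, 'n::finite) lpa)"
proof -
  have "lpa_rel (\<Sum>i\<in>UNIV. free_gen (Edge i) * free_gen (Ghost i)) (1 :: ('k, 'n) free_alg)"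
    using lpa_ideal.rel[of "(\<Sum>i\<in>UNIV. free_gen (Edge i) * free_gen (Ghost i)) -
        (1 :: ('k, 'n) free_alg)" 1 1]
    by (auto simp: lpa_rel_def lpa_relators_def)
  then have "abs_lpa (\<Sum>i\<in>UNIV. free_gen (Edge i) * free_gen (Ghost i)) = (1 :: ('k, 'n) lpa)"
    by (simp add: one_lpa_def lpa.abs_eq_iff)
  then show ?thesis
    by (simp add: abs_lpa_sum edge_def ghost_def times_lpa.abs_eq)
qed

lemma path_act_edge:
  "path_act (edge i) (Poly_Mapping.single \<beta> 1) = Poly_Mapping.single (i ## \<beta>) 1"
  by transfer (simp add: free_act_gen gen_act_def vscale_single)

lemma path_act_ghost:
  "path_act (ghost i) (Poly_Mapping.single \<beta> 1) =
     (if shd \<beta> = i then Poly_Mapping.single (stl \<beta>) 1 else 0)"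
  by transfer (simp add: free_act_gen gen_act_def vscale_single)

lemma path_act_add: "path_act r (\<phi> + \<psi>) = path_act r \<phi> + path_act r \<psi>"
  by transfer (rule free_act_add_right)

lemma path_act_add_left: "path_act (r + s) \<phi> = path_act r \<phi> + path_act s \<phi>"
  by transfer (rule free_act_add_left)

lemma path_act_mult: "path_act (r * s) \<phi> = path_act r (path_act s \<phi>)"
  by transfer (rule free_act_mult)

lemma path_act_one: "path_act 1 \<phi> = \<phi>"
  by transfer simp

section \<open>Left modules over a ring\<close>

record ('r, 'm) lmod =
  mcarrier :: "'m set"
  madd :: "'m \<Rightarrow> 'm \<Rightarrow> 'm"
  mzero :: "'m"
  msmult :: "'r \<Rightarrow> 'm \<Rightarrow> 'm"

locale left_module =
  fixes M :: "('r::ring_1, 'm) lmod"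
  assumes zero_closed: "mzero M \<in> mcarrier M"
    and add_closed: "\<And>x y. x \<in> mcarrier M \<Longrightarrow> y \<in> mcarrier M \<Longrightarrow> madd M x y \<in> mcarrier M"
    and smult_closed: "\<And>r x. x \<in> mcarrier M \<Longrightarrow> msmult M r x \<in> mcarrier M"
    and add_assoc: "\<And>x y z. x \<in> mcarrier M \<Longrightarrow> y \<in> mcarrier M \<Longrightarrow> z \<in> mcarrier M \<Longrightarrow>
          madd M (madd M x y) z = madd M x (madd M y z)"
    and add_comm: "\<And>x y. x \<in> mcarrier M \<Longrightarrow> y \<in> mcarrier M \<Longrightarrow> madd M x y = madd M y x"
    and add_zero: "\<And>x. x \<in> mcarrier M \<Longrightarrow> madd M (mzero M) x = x"
    and add_inverse: "\<And>x. x \<in> mcarrier M \<Longrightarrow> \<exists>y\<in>mcarrier M. madd M y x = mzero M"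
    and smult_add: "\<And>r x y. x \<in> mcarrier M \<Longrightarrow> y \<in> mcarrier M \<Longrightarrow>
          msmult M r (madd M x y) = madd M (msmult M r x) (msmult M r y)"
    and add_smult: "\<And>r s x. x \<in> mcarrier M \<Longrightarrow>
          msmult M (r + s) x = madd M (msmult M r x) (msmult M s x)"
    and smult_smult: "\<And>r s x. x \<in> mcarrier M \<Longrightarrow>
          msmult M (r * s) x = msmult M r (msmult M s x)"
    and one_smult: "\<And>x. x \<in> mcarrier M \<Longrightarrow> msmult M 1 x = x"

definition submodule :: "('r::ring_1, 'm) lmod \<Rightarrow> 'm set \<Rightarrow> bool" where
  "submodule M N \<longleftrightarrow> N \<subseteq> mcarrier M \<and> mzero M \<in> N \<and>
     (\<forall>x\<in>N. \<forall>y\<in>N. madd M x y \<in> N) \<and> (\<forall>r. \<forall>x\<in>N. msmult M r x \<in> N)"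

definition simple_module :: "('r::ring_1, 'm) lmod \<Rightarrow> bool" where
  "simple_module M \<longleftrightarrow> left_module M \<and> mcarrier M \<noteq> {mzero M} \<and>
     (\<forall>N. submodule M N \<longrightarrow> N = {mzero M} \<or> N = mcarrier M)"

definition iso_module :: "('r::ring_1, 'm1) lmod \<Rightarrow> ('r, 'm2) lmod \<Rightarrow> bool"
    (infix \<open>\<cong>\<^sub>m\<close> 50) where
  "M \<cong>\<^sub>m N \<longleftrightarrow> (\<exists>h. bij_betw h (mcarrier M) (mcarrier N) \<and>
     (\<forall>x\<in>mcarrier M. \<forall>y\<in>mcarrier M. h (madd M x y) = madd N (h x) (h y)) \<and>
     (\<forall>r. \<forall>x\<in>mcarrier M. h (msmult M r x) = msmult N r (h x)))"

text \<open>\<open>R/J\<close> for a left ideal \<open>J\<close>; its elements are the cosets \<open>a + J\<close>.\<close>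

definition lcoset :: "'r::ring_1 set \<Rightarrow> 'r \<Rightarrow> 'r set" where
  "lcoset J a = {a + j | j. j \<in> J}"

definition quot_module :: "'r::ring_1 set \<Rightarrow> ('r, 'r set) lmod" where
  "quot_module J =
     \<lparr>mcarrier = range (lcoset J),
      madd = (\<lambda>X Y. {x + y | x y. x \<in> X \<and> y \<in> Y}),
      mzero = J,
      msmult = (\<lambda>r X. {r * x + j | x j. x \<in> X \<and> j \<in> J})\<rparr>"

definition left_principal :: "'r::ring_1 \<Rightarrow> 'r set" where
  "left_principal a = {r * a | r. True}"

definition twist :: "('r::ring_1 \<Rightarrow> 'r) \<Rightarrow> ('r, 'm) lmod \<Rightarrow> ('r, 'm) lmod" where
  "twist \<sigma> M = M\<lparr>msmult := (\<lambda>r x. msmult M (\<sigma> r) x)\<rparr>"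

section \<open>Infinite paths and the modules \<open>V\<^bsub>[\<alpha>]\<^esub>\<close>\<close>

definition tail_equiv :: "'n stream \<Rightarrow> 'n stream \<Rightarrow> bool" where
  "tail_equiv \<alpha> \<beta> \<longleftrightarrow> (\<exists>m l. 0 < m \<and> 0 < l \<and> sdrop m \<alpha> = sdrop l \<beta>)"

definition tail_class :: "'n stream \<Rightarrow> 'n stream set" where
  "tail_class \<alpha> = {\<beta>. tail_equiv \<alpha> \<beta>}"

text \<open>Closed paths of the rose are the nonempty words in its petals.\<close>

definition irrational_paths :: "'n stream set" where
  "irrational_paths = {\<alpha>. \<not> (\<exists>c. c \<noteq> [] \<and> tail_equiv \<alpha> (cycle c))}"

definition V_module ::
  "'n::finite stream set \<Rightarrow> (('k::field, 'n) lpa, 'n stream \<Rightarrow>\<^sub>0 'k) lmod" where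
  "V_module C =
     \<lparr>mcarrier = {\<phi>. Poly_Mapping.keys \<phi> \<subseteq> C}, madd = (+), mzero = 0, msmult = path_act\<rparr>"

section \<open>Simple closed paths and the modules \<open>S\<^sup>f\<^sub>c\<close>\<close>

definition SCP :: "'n list set" where
  "SCP = {c. c \<noteq> [] \<and> \<not> (\<exists>d k. d \<noteq> [] \<and> 2 \<le> k \<and> c = concat (replicate k d))}"

definition rotations :: "'n list \<Rightarrow> 'n list set" where
  "rotations c = {rotate i c | i. i < length c}"

text \<open>
  \<open>C\<^sub>s\<close> relative to the petal \<open>i2\<close> (playing the role of \<open>e\<^sub>2\<close>): simple closed paths that end in
  \<open>i2\<close> and do not contain \<open>i2\<close> elsewhere.
\<close>

definition C_s :: "'n \<Rightarrow> 'n list set" where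
  "C_s i2 = {c \<in> SCP. last c = i2 \<and> (\<forall>k\<in>set (butlast c). k \<noteq> i2)}"

definition Irr_poly :: "'k::field poly set" where
  "Irr_poly = {f. irreducible f \<and> poly.coeff f 0 = 1}"

definition path_elem :: "'n list \<Rightarrow> ('k::field, 'n::finite) lpa" where
  "path_elem c = prod_list (map edge c)"

definition poly_at :: "'k::field poly \<Rightarrow> ('k, 'n::finite) lpa \<Rightarrow> ('k, 'n) lpa" where
  "poly_at f x = (\<Sum>i\<le>Polynomial.degree f. lpa_scalar (poly.coeff f i) * x ^ i)"

definition S_module ::
  "'k::field poly \<Rightarrow> 'n list \<Rightarrow> (('k, 'n::finite) lpa, ('k, 'n) lpa set) lmod" where
  "S_module f c = quot_module (left_principal (poly_at f (path_elem c)))"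

section \<open>The twisted modules \<open>S\<^sup>f\<^sup>,\<^sup>p\<^sub>d\<close>\<close>

inductive_set generated_subalg :: "('k::field, 'n::finite) lpa set \<Rightarrow> ('k, 'n) lpa set"
  for G where
  gen: "g \<in> G \<Longrightarrow> g \<in> generated_subalg G"
| scalar: "lpa_scalar a \<in> generated_subalg G"
| add: "x \<in> generated_subalg G \<Longrightarrow> y \<in> generated_subalg G \<Longrightarrow> x + y \<in> generated_subalg G"
| mult: "x \<in> generated_subalg G \<Longrightarrow> y \<in> generated_subalg G \<Longrightarrow> x * y \<in> generated_subalg G"

text \<open>\<open>i1\<close> and \<open>i2\<close> are the petals \<open>e\<^sub>1\<close> and \<open>e\<^sub>2\<close>.\<close>

definition A_subalg :: "'n \<Rightarrow> 'n \<Rightarrow> ('k::field, 'n::finite) lpa set" where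
  "A_subalg i1 i2 = generated_subalg ({edge i | i. i \<noteq> i2} \<union> {ghost i | i. i \<noteq> i1})"

definition lpa_automorphism :: "(('k::field, 'n::finite) lpa \<Rightarrow> ('k, 'n) lpa) \<Rightarrow> bool" where
  "lpa_automorphism \<sigma> \<longleftrightarrow> bij \<sigma> \<and> (\<forall>x y. \<sigma> (x + y) = \<sigma> x + \<sigma> y) \<and>
     (\<forall>x y. \<sigma> (x * y) = \<sigma> x * \<sigma> y) \<and> (\<forall>a. \<sigma> (lpa_scalar a) = lpa_scalar a)"

definition sigma ::
  "'n \<Rightarrow> 'n \<Rightarrow> ('k::field, 'n::finite) lpa \<Rightarrow> ('k, 'n) lpa \<Rightarrow> ('k, 'n) lpa" where
  "sigma i1 i2 p = (THE \<sigma>. lpa_automorphism \<sigma> \<and>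
     \<sigma> (edge i2) = edge i2 + edge i1 * p \<and>
     \<sigma> (ghost i1) = ghost i1 - p * ghost i2 \<and>
     (\<forall>a\<in>A_subalg i1 i2. \<sigma> a = a))"

definition S_twisted ::
  "'n \<Rightarrow> 'n \<Rightarrow> 'k::field poly \<Rightarrow> ('k, 'n::finite) lpa \<Rightarrow> 'n list \<Rightarrow>
     (('k, 'n) lpa, ('k, 'n) lpa set) lmod" where
  "S_twisted i1 i2 f p d = twist (sigma i1 i2 p) (S_module f d)"

definition equiv_fd ::
  "'k::field poly \<Rightarrow> 'n list \<Rightarrow> ('k, 'n::finite) lpa \<Rightarrow> ('k, 'n) lpa \<Rightarrow> bool" where
  "equiv_fd f d p q \<longleftrightarrow> (\<exists>r. p - q = r * poly_at f (path_elem d))"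

definition equiv_class ::
  "'n \<Rightarrow> 'n \<Rightarrow> 'k::field poly \<Rightarrow> 'n list \<Rightarrow> ('k, 'n::finite) lpa \<Rightarrow> ('k, 'n) lpa set" where
  "equiv_class i1 i2 f d p = {q \<in> A_subalg i1 i2. equiv_fd f d p q}"

text \<open>
  The index set of the third family, with a triple \<open>(f, d, [p])\<close> represented by any \<open>(f, d, p)\<close>.
\<close>

definition twisted_index ::
  "'n \<Rightarrow> 'n \<Rightarrow> ('k::field poly \<times> 'n list \<times> ('k, 'n::finite) lpa) set" where
  "twisted_index i1 i2 = {(f, d, p). f \<in> Irr_poly \<and> d \<in> C_s i2 \<and> p \<in> A_subalg i1 i2 \<and>
     equiv_class i1 i2 f d 0 \<noteq> equiv_class i1 i2 f d p}"

end

theory Submission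
  imports Defs "HOL-Library.Function_Algebras"
begin

text \<open>
  Write \<open>J\<close> for the left ideal generated by \<open>f(c)\<close>. Modulo \<open>J\<close>, stripping a long enough prefix from an
  element by ghost edges lands in \<open>t K[c]\<close> for a tail \<open>t\<close> of \<open>c\<close>, and \<open>K[c]\<close> acts on the generator
  through the field \<open>K[x]/(f)\<close>; hence \<open>S\<^sup>f\<^sub>c\<close> is simple.

  A basis path \<open>\<alpha>\<close> of \<open>V\<^bsub>[\<alpha>]\<^esub>\<close>, and the generator of \<open>S\<^sup>f\<^sub>c\<close> with \<open>\<alpha> = c\<^sup>\<infinity>\<close>, is concentrated on \<open>\<alpha>\<close>:
  it is fixed by \<open>w w\<^sup>*\<close> for every prefix \<open>w\<close> of \<open>\<alpha>\<close>, and an isomorphism transports this. In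
  \<open>S\<^sup>f\<^sub>c\<close> the reduction above shows that a nonzero element can only be concentrated on a path
  tail-equivalent to \<open>c\<^sup>\<infinity>\<close>. In the twist of \<open>S\<^sup>f\<^sub>d\<close> by \<open>\<sigma>\<^sub>p\<close> the twisted ghost edges act on a
  concentrated element like the untwisted ones, so eventually it becomes a nonzero multiple
  \<open>e\<^sub>2 q(d)\<close> of the generator; being in the image of \<open>\<sigma>\<^sub>p(e\<^sub>2) = e\<^sub>2 + e\<^sub>1 p\<close> forces \<open>p q(d) = 0\<close>,
  that is \<open>p \<equiv> 0\<close>. Two twists by \<open>p\<close> and \<open>q\<close> are compared through \<open>\<sigma>\<^sub>q\<^sub>-\<^sub>p\<close>.
\<close>

section \<open>Simple closed paths\<close>

lemma SCP_not_Nil: "c \<in> SCP \<Longrightarrow> c \<noteq> []"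
  by (simp add: SCP_def)

text \<open>If a rotation by \<open>r\<close> fixes \<open>c\<close>, the two pieces of
  \<open>c\<close> cut at \<open>r\<close> commute, and commuting words are powers of a common word.
  Conversely, rotation by one period fixes a proper power.\<close>

lemma SCP_iff_rotate:
  "c \<in> SCP \<longleftrightarrow> c \<noteq> [] \<and> (\<forall>r. 0 < r \<longrightarrow> r < length c \<longrightarrow> rotate r c \<noteq> c)"
proof (intro iffI conjI allI impI notI)
  fix r assume c: "c \<in> SCP" and r: "0 < r" "r < length c" "rotate r c = c"
  have "drop r c @ take r c = take r c @ drop r c"
    using r by (simp add: rotate_drop_take)
  moreover have "drop r c \<noteq> []" "take r c \<noteq> []" using r by auto
  ultimately obtain n zs where n: "1 < n" "concat (replicate n zs) = drop r c @ take r c"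
    using comm_append_is_replicate by metis
  then have "concat (replicate n zs) = c" "zs \<noteq> []"
    using r by (auto simp: rotate_drop_take)
  then have "\<exists>d k. d \<noteq> [] \<and> 2 \<le> k \<and> c = concat (replicate k d)"
    using n(1) by (intro exI[of _ zs] exI[of _ n]) auto
  with c show False unfolding SCP_def by blast
next
  assume c: "c \<noteq> [] \<and> (\<forall>r. 0 < r \<longrightarrow> r < length c \<longrightarrow> rotate r c \<noteq> c)"
  have False if d: "d \<noteq> []" "2 \<le> k" "c = concat (replicate k d)" for d k
  proof -
    obtain j where k: "k = Suc j" "0 < j" using d(2) by (cases k) auto
    have "c = d @ concat (replicate j d)" using d(3) k by simp
    moreover have "concat (replicate j d) @ d = d @ concat (replicate j d)" for j
      by (induction j) auto
    ultimately have "rotate (length d) c = c" by (simp add: rotate_append)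
    moreover have "length d < length c"
      using d k by (simp add: length_concat sum_list_replicate)
    ultimately show False using c d by auto
  qed
  with c show "c \<in> SCP" by (auto simp: SCP_def)
qed (auto simp: SCP_def)

lemma rotate_mod_cancel:
  assumes "rotate r c = rotate s c" "r \<le> s"
  shows "rotate (s - r) c = c"
proof (cases "c = []")
  case False
  \<comment> \<open>Rotating by \<open>m\<close> undoes the rotation by \<open>r\<close>, because
    \<open>m + r\<close> is a multiple of the length of \<open>c\<close>.\<close>
  define m where "m = length c * r - r"
  have len: "m + r = length c * r" "m + s = length c * r + (s - r)"
    using assms(2) False by (simp_all add: m_def Suc_le_eq)
  have "rotate (m + r) c = rotate (m + s) c"
    using assms(1) by (metis rotate_rotate)
  moreover have "rotate (m + r) c = c"
    unfolding len by (simp add: rotate_id)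
  moreover have "rotate (m + s) c = rotate (s - r) c"
    unfolding len by (subst (1 2) rotate_conv_mod) simp
  ultimately show ?thesis by simp
qed simp

text \<open>Any \<open>length c\<close> consecutive letters of \<open>cycle c\<close> thus determine
  the position in the period; the additivity of \<open>reduces\<close> rests on this.\<close>

lemma rotate_SCP_inj:
  assumes "c \<in> SCP" "r < length c" "s < length c" "rotate r c = rotate s c"
  shows "r = s"
proof (rule ccontr)
  assume "r \<noteq> s"
  then have "\<exists>t. 0 < t \<and> t < length c \<and> rotate t c = c"
    using rotate_mod_cancel[of r c s] rotate_mod_cancel[of s c r] assms(2-4)
    by (cases "r < s") (auto intro: exI[of _ "s - r"] exI[of _ "r - s"])
  with assms(1) show False by (auto simp: SCP_iff_rotate)
qed

lemma rotate_SCP: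
  assumes "c \<in> SCP" shows "rotate s c \<in> SCP"
  unfolding SCP_iff_rotate
proof (intro conjI allI impI notI)
  fix r assume r: "0 < r" "r < length (rotate s c)" "rotate r (rotate s c) = rotate s c"
  then have "rotate (r + s) c = rotate s c" by (simp add: rotate_rotate)
  then have "rotate r c = c" using rotate_mod_cancel[of s c "r + s"] by simp
  then show False using assms r by (auto simp: SCP_iff_rotate)
qed (use assms in \<open>simp add: SCP_def\<close>)

text \<open>The common infinite path starts with both \<open>c @ d\<close> and \<open>d @ c\<close>,
  so the two words commute and are powers of one word; simplicity makes both exponents 1.\<close>

lemma cycle_inj_SCP:
  assumes c: "c \<in> SCP" and d: "d \<in> SCP" and eq: "cycle c = cycle d"
  shows "c = d"
proof -
  note ne = c[THEN SCP_not_Nil] d[THEN SCP_not_Nil]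
  have cd: "cycle c = (c @ d) @- cycle d" "cycle c = (d @ c) @- cycle c"
    using cycle_decomp[OF ne(1)] cycle_decomp[OF ne(2)] eq by (metis shift_append)+
  have "c @ d = stake (length c + length d) (cycle c)" by (subst cd(1)) (simp add: stake_shift)
  also have "\<dots> = d @ c" by (subst cd(2)) (simp add: stake_shift)
  finally obtain m n zs where z: "concat (replicate m zs) = c" "concat (replicate n zs) = d"
    using comm_append_are_replicate by metis
  have "k = 1" if "concat (replicate k zs) = b" "b \<in> SCP" for k b
  proof -
    have "zs \<noteq> []" "k \<noteq> 0" using that by (auto simp: SCP_def)
    with that show ?thesis by (cases "2 \<le> k") (auto simp: SCP_def)
  qed
  from this[OF z(1) c] this[OF z(2) d] show ?thesis using z by simp
qed

lemma sdrop_cycle_less: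
  assumes "r < length c"
  shows "sdrop r (cycle c) = drop r c @- cycle c" "sdrop r (cycle c) = cycle (rotate r c)"
proof -
  have "c \<noteq> []" using assms by auto
  then have "sdrop r (cycle c) = sdrop r (c @- cycle c)" by (simp flip: cycle_decomp)
  then show "sdrop r (cycle c) = drop r c @- cycle c" using assms by (simp add: sdrop_shift)
  show "sdrop r (cycle c) = cycle (rotate r c)"
    using \<open>c \<noteq> []\<close> assms by (simp add: sdrop_cycle)
qed

lemma rotations_rotate:
  assumes "r < length c"
  shows "rotations (rotate r c) = rotations c"
proof
  show "rotations (rotate r c) \<subseteq> rotations c"
  proof
    fix x assume "x \<in> rotations (rotate r c)"
    then obtain i where "x = rotate (i + r) c" by (auto simp: rotations_def rotate_rotate)
    then have "x = rotate ((i + r) mod length c) c" by (metis rotate_conv_mod)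
    moreover have "(i + r) mod length c < length c" using assms by (intro mod_less_divisor) auto
    ultimately show "x \<in> rotations c" by (auto simp: rotations_def)
  qed
  show "rotations c \<subseteq> rotations (rotate r c)"
  proof
    fix x assume "x \<in> rotations c"
    then obtain i where x: "x = rotate i c" by (auto simp: rotations_def)
    define j where "j = (i + (length c - r)) mod length c"
    have "rotate j (rotate r c) = rotate ((i + (length c - r)) + r) c"
      unfolding j_def rotate_rotate by (subst (1 2) rotate_conv_mod) (simp add: mod_simps)
    also have "(i + (length c - r)) + r = i + length c" using assms by simp
    also have "rotate (i + length c) c = x" unfolding x by (subst (1 2) rotate_conv_mod) simp
    finally have "x = rotate j (rotate r c)" by simp
    moreover have "j < length c" using assms unfolding j_def by (intro mod_less_divisor) auto
    ultimately show "x \<in> rotations (rotate r c)" by (auto simp: rotations_def)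
  qed
qed

lemma C_s_SCP: "d \<in> C_s i \<Longrightarrow> d \<in> SCP"
  by (simp add: C_s_def)

text \<open>The petal \<open>i\<close> occurs in such a path only as the last letter, whereas a
  nontrivial rotation ends in a letter from the interior.\<close>

lemma C_s_rotations_inj:
  assumes c: "c \<in> C_s i" and d: "d \<in> C_s i" and eq: "rotations c = rotations d"
  shows "c = d"
proof -
  have "d \<in> rotations d" using d by (auto simp: rotations_def C_s_def SCP_def intro!: exI[of _ 0])
  then obtain r where r: "d = rotate r c" "r < length c" using eq by (auto simp: rotations_def)
  have "r = 0"
  proof (rule ccontr)
    assume "r \<noteq> 0"
    then have "last d = last (take r c)" using r by (auto simp: rotate_drop_take last_append)
    also have "last (take r c) \<in> set (take r (butlast c))"
      using r \<open>r \<noteq> 0\<close> by (metis take_butlast last_in_set length_0_conv length_take less_imp_le min.absorb2 min.commute)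
    finally have "last d \<in> set (butlast c)" by (rule in_set_takeD)
    then show False using c d by (auto simp: C_s_def)
  qed
  then show ?thesis using r by simp
qed

section \<open>Elements of the Leavitt path algebra\<close>

lemma lpa_scalar_add: "lpa_scalar (a + b) = lpa_scalar a + lpa_scalar b"
  by transfer (simp add: single_add lpa_rel_def lpa_ideal.zero)

lemma lpa_scalar_mult: "lpa_scalar (a * b) = lpa_scalar a * lpa_scalar b"
  by transfer (simp add: mult_single lpa_rel_def lpa_ideal.zero plus_list_def)

lemma lpa_scalar_one [simp]: "lpa_scalar 1 = 1"
  by transfer (simp add: lpa_rel_def lpa_ideal.zero zero_list_def flip: single_one)

lemma lpa_scalar_zero [simp]: "lpa_scalar 0 = 0"
  by transfer (simp add: lpa_rel_def lpa_ideal.zero)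

lemma lpa_scalar_commute: "lpa_scalar a * x = x * lpa_scalar a"
proof -
  have "Poly_Mapping.single [] a * x = x * Poly_Mapping.single [] a" for x :: "('a, 'b) free_alg"
    by (induction x rule: single_induct)
       (simp_all add: mult_single distrib_left distrib_right plus_list_def mult.commute)
  then show ?thesis by transfer (simp add: lpa_rel_def lpa_ideal.zero)
qed

text \<open>Monomials grow by generators multiplied on the left, which suits properties of left
  ideals and of module actions.\<close>

lemma lpa_induct [case_names one scalar add edge ghost]:
  fixes x :: "('k::field, 'n::finite) lpa"
  assumes one: "P 1"
    and scalar: "\<And>a x. P x \<Longrightarrow> P (lpa_scalar a * x)"
    and add: "\<And>x y. P x \<Longrightarrow> P y \<Longrightarrow> P (x + y)"
    and edge: "\<And>i x. P x \<Longrightarrow> P (edge i * x)"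
    and ghost: "\<And>i x. P x \<Longrightarrow> P (ghost i * x)"
  shows "P x"
proof -
  have word: "P (abs_lpa (Poly_Mapping.single w 1))" for w
  proof (induction w)
    case Nil
    then show ?case using one by (simp add: one_lpa_def zero_list_def flip: single_one)
  next
    case (Cons g w)
    have "abs_lpa (Poly_Mapping.single (g # w) 1) =
        (abs_lpa (free_gen g) * abs_lpa (Poly_Mapping.single w 1) :: ('k, 'n) lpa)"
      by (simp add: times_lpa.abs_eq free_gen_def mult_single plus_list_def)
    then show ?case using edge[OF Cons] ghost[OF Cons]
      by (cases g) (simp_all add: edge_def ghost_def)
  qed
  have "P (abs_lpa y)" for y
  proof (induction y rule: single_induct)
    case zero
    then show ?case using scalar[OF one, of 0] by (simp add: zero_lpa_def)
  next
    case (single w a)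
    have "abs_lpa (Poly_Mapping.single w a) =
        (lpa_scalar a * abs_lpa (Poly_Mapping.single w 1) :: ('k, 'n) lpa)"
      by (simp add: lpa_scalar_def times_lpa.abs_eq mult_single plus_list_def)
    then show ?case using scalar[OF word] by simp
  next
    case (add x y)
    then show ?case using assms(3) by (simp flip: plus_lpa.abs_eq)
  qed
  then show ?thesis by (metis Quotient_lpa Quotient_abs_rep)
qed

text \<open>The adjoint of \<open>path_elem w\<close>: the word is reversed so that the first letter
  of \<open>w\<close> is the first to be stripped.\<close>

definition ghost_path :: "'n list \<Rightarrow> ('k::field, 'n::finite) lpa" where
  "ghost_path w = prod_list (map ghost (rev w))"

lemma path_elem_simps [simp]:
  "path_elem [] = 1" "path_elem (i # w) = edge i * path_elem w"
  by (simp_all add: path_elem_def)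

lemma path_elem_append: "path_elem (u @ w) = path_elem u * path_elem w"
  by (simp add: path_elem_def)

lemma path_elem_power: "path_elem c ^ k = path_elem (concat (replicate k c))"
  by (induction k) (simp_all add: path_elem_append)

lemma ghost_path_simps [simp]:
  "ghost_path [] = 1" "ghost_path (i # w) = ghost_path w * ghost i"
  by (simp_all add: ghost_path_def)

lemma ghost_path_append: "ghost_path (u @ w) = ghost_path w * ghost_path u"
  by (simp add: ghost_path_def)

lemma ghost_path_path_elem:
  "length u = length w \<Longrightarrow> ghost_path u * path_elem w = (if u = w then 1 else 0)"
proof (induction u w rule: list_induct2)
  case (Cons i u j w)
  have "ghost_path (i # u) * path_elem (j # w) = ghost_path u * (ghost i * edge j) * path_elem w"
    by (simp add: mult.assoc)
  then show ?case using Cons by (auto simp: ghost_edge)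
qed simp

lemma ghost_path_path_elem_self [simp]:
  "ghost_path u * path_elem u = (1 :: ('k::field, 'n::finite) lpa)"
  "ghost_path u * (path_elem u * x) = (x :: ('k, 'n) lpa)"
  by (simp_all add: ghost_path_path_elem flip: mult.assoc)

lemma ghost_path_take:
  assumes "length u \<le> length w"
  shows "(ghost_path u * path_elem w :: ('k::field, 'n::finite) lpa) =
    (if u = take (length u) w then path_elem (drop (length u) w) else 0)"
proof -
  have "(ghost_path u * path_elem w :: ('k, 'n) lpa) =
      ghost_path u * path_elem (take (length u) w) * path_elem (drop (length u) w)"
    by (metis append_take_drop_id mult.assoc path_elem_append)
  also have "ghost_path u * path_elem (take (length u) w) =
      (if u = take (length u) w then 1 else (0 :: ('k, 'n) lpa))"
    using assms by (intro ghost_path_path_elem) simp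
  finally show ?thesis by simp
qed

lemma poly_at_superset:
  assumes "Polynomial.degree f \<le> N"
  shows "poly_at f x = (\<Sum>i\<le>N. lpa_scalar (poly.coeff f i) * x ^ i)"
  unfolding poly_at_def using assms by (intro sum.mono_neutral_left) (auto simp: coeff_eq_0)

lemma poly_at_add: "poly_at (f + g) x = poly_at f x + poly_at g x"
proof -
  let ?N = "max (Polynomial.degree f) (Polynomial.degree g)"
  show ?thesis
    using degree_add_le[of f ?N g]
    by (simp add: poly_at_superset[of _ ?N] lpa_scalar_add distrib_right sum.distrib)
qed

lemma poly_at_pCons: "poly_at (pCons a f) x = lpa_scalar a + poly_at f x * x"
proof -
  have "poly_at (pCons a f) x =
      (\<Sum>i\<le>Suc (Polynomial.degree f). lpa_scalar (poly.coeff (pCons a f) i) * x ^ i)"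
    by (intro poly_at_superset degree_pCons_le)
  then show ?thesis
    unfolding sum.atMost_Suc_shift
    by (simp add: poly_at_def sum_distrib_right mult.assoc power_Suc2 del: power_Suc)
qed

lemma poly_at_zero [simp]: "poly_at 0 x = 0"
  by (simp add: poly_at_def)

lemma poly_at_one [simp]: "poly_at 1 x = 1"
  by (simp add: poly_at_pCons one_pCons)

lemma poly_at_x: "poly_at [:0, 1:] x = x"
  by (simp add: poly_at_pCons)

lemma poly_at_smult: "poly_at (Polynomial.smult a f) x = lpa_scalar a * poly_at f x"
  by (induction f) (simp_all add: poly_at_pCons lpa_scalar_mult distrib_left mult.assoc)

lemma poly_at_commute: "poly_at f x * x = x * poly_at f x"
proof (induction f)
  case (pCons a f)
  then show ?case
    by (simp add: poly_at_pCons lpa_scalar_commute[of _ x] distrib_left distrib_right mult.assoc)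
qed simp

lemma poly_at_mult: "poly_at (f * g) x = poly_at f x * poly_at g x"
  by (induction f)
     (simp_all add: poly_at_pCons poly_at_add poly_at_smult distrib_left distrib_right mult.assoc
       flip: poly_at_commute[of _ x])

lemma poly_at_minus: "poly_at (f - g) x = poly_at f x - poly_at g x"
  using poly_at_add[of "f - g" g x] by simp

lemma poly_at_power: "poly_at (f ^ k) x = poly_at f x ^ k"
  by (induction k) (simp_all add: poly_at_mult)

section \<open>The universal property\<close>

lemma abs_rep_lpa [simp]: "abs_lpa (rep_lpa r) = r"
  using Quotient_lpa by (rule Quotient_abs_rep)

lemma lpa_abs_cases:
  obtains x where "r = abs_lpa x"
  using abs_rep_lpa[of r] by metis

text \<open>Operators that satisfy the Leavitt relations extend to an action of the quotient
  algebra. This serves twice: on the algebra itself to construct endomorphisms, and on a space of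
  functions to see that the left ideals are proper.\<close>

locale lpa_family =
  fixes s :: "'k::field \<Rightarrow> 'w::ab_group_add \<Rightarrow> 'w" and G :: "'n::finite gen \<Rightarrow> 'w \<Rightarrow> 'w"
  assumes s_add: "s a (y + z) = s a y + s a z"
    and s_add_left: "s (a + b) y = s a y + s b y"
    and s_mult: "s (a * b) y = s a (s b y)"
    and s_one: "s 1 y = y"
    and G_add: "G g (y + z) = G g y + G g z"
    and G_s: "G g (s a y) = s a (G g y)"
    and G_ghost_edge: "G (Ghost i) (G (Edge j) y) = (if i = j then y else 0)"
    and G_edge_ghost: "(\<Sum>i\<in>UNIV. G (Edge i) (G (Ghost i) y)) = y"
begin

definition free_op :: "('k, 'n) free_alg \<Rightarrow> 'w \<Rightarrow> 'w" where
  "free_op x y = (\<Sum>w\<in>Poly_Mapping.keys x. s (Poly_Mapping.lookup x w) (foldr G w y))"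

lemma s_zero_left: "s 0 y = 0"
  using s_add_left[of 0 0 y] by simp

lemma s_zero: "s a 0 = 0"
  using s_add[of a 0 0] by simp

lemma free_op_superset:
  assumes "finite A" "Poly_Mapping.keys x \<subseteq> A"
  shows "free_op x y = (\<Sum>w\<in>A. s (Poly_Mapping.lookup x w) (foldr G w y))"
  unfolding free_op_def using assms
  by (intro sum.mono_neutral_left) (auto simp: in_keys_iff s_zero_left)

lemma free_op_zero: "free_op 0 y = 0"
  by (simp add: free_op_def)

lemma free_op_add: "free_op (x + x') y = free_op x y + free_op x' y"
proof -
  let ?A = "Poly_Mapping.keys x \<union> Poly_Mapping.keys x'"
  have "finite ?A" "Poly_Mapping.keys (x + x') \<subseteq> ?A"
    using keys_add[of x x'] by auto
  then show ?thesis
    by (simp add: free_op_superset[of ?A] lookup_add s_add_left sum.distrib)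
qed

lemma free_op_diff: "free_op (x - x') y = free_op x y - free_op x' y"
  using free_op_add[of "x - x'" x' y] by simp

lemma free_op_sum: "free_op (sum f A) y = (\<Sum>a\<in>A. free_op (f a) y)"
  by (induction A rule: infinite_finite_induct) (simp_all add: free_op_add free_op_zero)

lemma free_op_single: "free_op (Poly_Mapping.single w a) y = s a (foldr G w y)"
  by (subst free_op_superset[of "{w}"]) (auto simp: lookup_single)

lemma free_op_one: "free_op 1 y = y"
  by (simp add: free_op_single s_one zero_list_def flip: single_one)

lemma free_op_gen: "free_op (free_gen g) y = G g y"
  by (simp add: free_gen_def free_op_single s_one)

lemma foldr_G_add: "foldr G w (y + z) = foldr G w y + foldr G w z"
  by (induction w) (simp_all add: G_add)

lemma foldr_G_s: "foldr G w (s a y) = s a (foldr G w y)"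
  by (induction w) (simp_all add: G_s)

lemma free_op_add_right: "free_op x (y + z) = free_op x y + free_op x z"
  by (simp add: free_op_def foldr_G_add s_add sum.distrib)

lemma free_op_mult: "free_op (x * x') y = free_op x (free_op x' y)"
proof (induction x rule: single_induct)
  case (single u a)
  show ?case
  proof (induction x' rule: single_induct)
    case zero
    then show ?case using foldr_G_s[of u 0 0] by (simp add: free_op_zero free_op_single s_zero_left s_zero)
  next
    case (single w b)
    show ?case
      by (simp add: mult_single free_op_single plus_list_def foldr_G_s s_mult)
  qed (simp_all add: distrib_left free_op_add free_op_add_right)
qed (simp_all add: distrib_right free_op_add free_op_zero)

lemma free_op_ideal: "r \<in> lpa_ideal \<Longrightarrow> free_op r y = 0"
proof (induction arbitrary: y rule: lpa_ideal.induct)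
  case (rel r x z)
  have "free_op r y = 0" for y
    using rel
    by (auto simp: lpa_relators_def free_op_diff free_op_mult free_op_gen free_op_sum
        free_op_one free_op_zero G_ghost_edge G_edge_ghost)
  then show ?case
    using free_op_add_right[of x 0 0] by (simp add: free_op_mult)
qed (simp_all add: free_op_zero free_op_add)

definition lpa_op :: "('k, 'n) lpa \<Rightarrow> 'w \<Rightarrow> 'w" where
  "lpa_op r = free_op (rep_lpa r)"

text \<open>The chosen representative does not matter: two of them differ by an element of the
  ideal, which acts as zero.\<close>

lemma lpa_op_abs: "lpa_op (abs_lpa x) y = free_op x y"
proof -
  have "lpa_rel (rep_lpa (abs_lpa x)) x"
    by (simp flip: lpa.abs_eq_iff)
  then have "free_op (rep_lpa (abs_lpa x) - x) y = 0"
    unfolding lpa_rel_def by (rule free_op_ideal)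
  then show ?thesis by (simp add: free_op_diff lpa_op_def)
qed

lemma lpa_op_add_left: "lpa_op (r + t) y = lpa_op r y + lpa_op t y"
  by (cases r rule: lpa_abs_cases; cases t rule: lpa_abs_cases)
    (simp add: plus_lpa.abs_eq lpa_op_abs free_op_add)

lemma lpa_op_mult: "lpa_op (r * t) y = lpa_op r (lpa_op t y)"
  by (cases r rule: lpa_abs_cases; cases t rule: lpa_abs_cases)
    (simp add: times_lpa.abs_eq lpa_op_abs free_op_mult)

lemma lpa_op_add: "lpa_op r (y + z) = lpa_op r y + lpa_op r z"
  by (simp add: lpa_op_def free_op_add_right)

lemma lpa_op_zero: "lpa_op r 0 = 0"
  using lpa_op_add[of r 0 0] by simp

lemma lpa_op_one: "lpa_op 1 y = y"
  by (simp add: one_lpa_def lpa_op_abs free_op_one)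

lemma lpa_op_scalar: "lpa_op (lpa_scalar a) y = s a y"
  by (simp add: lpa_scalar_def lpa_op_abs free_op_single)

lemma lpa_op_edge: "lpa_op (edge i) y = G (Edge i) y"
  by (simp add: edge_def lpa_op_abs free_op_gen)

lemma lpa_op_ghost: "lpa_op (ghost i) y = G (Ghost i) y"
  by (simp add: ghost_def lpa_op_abs free_op_gen)

end

section \<open>The automorphisms \<open>\<sigma>\<^sub>p\<close>\<close>

text \<open>Bijectivity, part of \<open>lpa_automorphism\<close>, is left out so that the universal
  property yields such maps directly; for \<open>sigma i1 i2 p\<close> it comes from an explicit
  inverse.\<close>

definition lpa_hom :: "(('k::field, 'n::finite) lpa \<Rightarrow> ('k, 'n) lpa) \<Rightarrow> bool" where
  "lpa_hom \<phi> \<longleftrightarrow> (\<forall>x y. \<phi> (x + y) = \<phi> x + \<phi> y) \<and> (\<forall>x y. \<phi> (x * y) = \<phi> x * \<phi> y) \<and>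
     (\<forall>a. \<phi> (lpa_scalar a) = lpa_scalar a)"

lemma lpa_homD:
  assumes "lpa_hom \<phi>"
  shows "\<phi> (x + y) = \<phi> x + \<phi> y" "\<phi> (x * y) = \<phi> x * \<phi> y" "\<phi> (lpa_scalar a) = lpa_scalar a"
    "\<phi> 1 = 1" "\<phi> 0 = 0"
  using assms lpa_scalar_one lpa_scalar_zero unfolding lpa_hom_def by metis+

lemma lpa_hom_diff: "lpa_hom \<phi> \<Longrightarrow> \<phi> (x - y) = \<phi> x - \<phi> y"
  using lpa_homD(1)[of \<phi> "x - y" y] by simp

lemma lpa_hom_comp: "lpa_hom \<phi> \<Longrightarrow> lpa_hom \<psi> \<Longrightarrow> lpa_hom (\<phi> \<circ> \<psi>)"
  by (simp add: lpa_hom_def)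

lemma lpa_hom_eqI:
  assumes "lpa_hom \<phi>" "lpa_hom \<psi>" "\<And>i. \<phi> (edge i) = \<psi> (edge i)" "\<And>i. \<phi> (ghost i) = \<psi> (ghost i)"
  shows "\<phi> = \<psi>"
proof
  fix x show "\<phi> x = \<psi> x"
    by (induction x rule: lpa_induct) (simp_all add: assms(3,4) lpa_homD[OF assms(1)] lpa_homD[OF assms(2)])
qed

text \<open>The algebra acts on itself through left multiplication by \<open>E\<close> and
  \<open>D\<close>; the homomorphism is the orbit map of 1.\<close>

lemma lpa_hom_exists:
  fixes E D :: "'n::finite \<Rightarrow> ('k::field, 'n) lpa"
  assumes DE: "\<And>i j. D i * E j = (if i = j then 1 else 0)" and ED: "(\<Sum>i\<in>UNIV. E i * D i) = 1"
  shows "\<exists>\<phi>. lpa_hom \<phi> \<and> (\<forall>i. \<phi> (edge i) = E i) \<and> (\<forall>i. \<phi> (ghost i) = D i)"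
proof -
  define G where "G g y = (case g of Edge i \<Rightarrow> E i | Ghost i \<Rightarrow> D i) * y" for g y
  have G_simps: "G (Edge i) y = E i * y" "G (Ghost i) y = D i * y" for i y
    by (simp_all add: G_def)
  interpret lpa_family "\<lambda>a y. lpa_scalar a * y" G
  proof
    show "G (Ghost i) (G (Edge j) y) = (if i = j then y else 0)" for i j y
      by (simp add: G_def DE flip: mult.assoc)
    show "(\<Sum>i\<in>UNIV. G (Edge i) (G (Ghost i) y)) = y" for y
      by (simp add: G_def ED flip: mult.assoc sum_distrib_right)
    show "G g (lpa_scalar a * y) = lpa_scalar a * G g y" for g a y
      by (simp add: G_def mult.assoc lpa_scalar_commute[of a])
  qed (simp_all add: G_def lpa_scalar_add lpa_scalar_mult distrib_left distrib_right mult.assoc)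
  \<comment> \<open>The action commutes with right multiplication, which makes the orbit map of 1
    multiplicative.\<close>
  have right: "lpa_op r (y * z) = lpa_op r y * z" for r y z
  proof (induction r arbitrary: y rule: lpa_induct)
    case one show ?case by (simp add: lpa_op_one)
  next
    case scalar then show ?case by (simp add: lpa_op_mult lpa_op_scalar mult.assoc)
  next
    case add then show ?case by (simp add: lpa_op_add_left distrib_right)
  next
    case edge then show ?case by (simp add: lpa_op_mult lpa_op_edge G_simps mult.assoc)
  next
    case ghost then show ?case by (simp add: lpa_op_mult lpa_op_ghost G_simps mult.assoc)
  qed
  define \<phi> where "\<phi> r = lpa_op r 1" for r
  have "\<phi> (x * y) = \<phi> x * \<phi> y" for x y
    unfolding \<phi>_def right[symmetric] by (simp add: lpa_op_mult)
  then have "lpa_hom \<phi>" by (simp add: lpa_hom_def \<phi>_def lpa_op_add_left lpa_op_scalar)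
  then show ?thesis
    by (intro exI[of _ \<phi>]) (simp add: \<phi>_def lpa_op_edge lpa_op_ghost G_simps)
qed

lemma lpa_hom_A_fixed:
  assumes "lpa_hom \<phi>" "\<And>i. i \<noteq> i2 \<Longrightarrow> \<phi> (edge i) = edge i" "\<And>i. i \<noteq> i1 \<Longrightarrow> \<phi> (ghost i) = ghost i"
    and "a \<in> A_subalg i1 i2"
  shows "\<phi> a = a"
  using assms(4) unfolding A_subalg_def
  by (induction rule: generated_subalg.induct) (auto simp: assms(2,3) lpa_homD[OF assms(1)])

lemma A_subalg_uminus:
  assumes "p \<in> A_subalg i1 i2" shows "- p \<in> A_subalg i1 i2"
proof -
  have "lpa_scalar (- 1) * p = - p"
    using lpa_scalar_add[of "- 1" 1] by (metis add.left_inverse eq_neg_iff_add_eq_0 lpa_scalar_one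
        lpa_scalar_zero mult_minus1)
  moreover have "lpa_scalar (- 1) * p \<in> A_subalg i1 i2"
    using assms unfolding A_subalg_def by (intro generated_subalg.mult generated_subalg.scalar)
  ultimately show ?thesis by simp
qed

lemma A_subalg_add:
  "p \<in> A_subalg i1 i2 \<Longrightarrow> q \<in> A_subalg i1 i2 \<Longrightarrow> p + q \<in> A_subalg i1 i2"
  unfolding A_subalg_def by (rule generated_subalg.add)

lemma A_subalg_diff:
  "p \<in> A_subalg i1 i2 \<Longrightarrow> q \<in> A_subalg i1 i2 \<Longrightarrow> p - q \<in> A_subalg i1 i2"
  using A_subalg_add[of p i1 i2 "- q"] A_subalg_uminus[of q i1 i2] by simp

lemma A_subalg_zero: "0 \<in> A_subalg i1 i2"
  unfolding A_subalg_def using generated_subalg.scalar[of 0] by simp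

locale petal_pair =
  fixes i1 i2 :: "'n::finite"
  assumes i1_neq_i2: "i1 \<noteq> i2"
begin

text \<open>An endomorphism is determined by its values on the generators, so this characterization
  is easier to compose than the definite description behind \<open>sigma\<close>.\<close>

definition is_sigma :: "('k::field, 'n) lpa \<Rightarrow> (('k, 'n) lpa \<Rightarrow> ('k, 'n) lpa) \<Rightarrow> bool" where
  "is_sigma p \<phi> \<longleftrightarrow> lpa_hom \<phi> \<and> (\<forall>i. \<phi> (edge i) = (if i = i2 then edge i2 + edge i1 * p else edge i)) \<and>
     (\<forall>i. \<phi> (ghost i) = (if i = i1 then ghost i1 - p * ghost i2 else ghost i))"

lemma is_sigma_unique: "is_sigma p \<phi> \<Longrightarrow> is_sigma p \<psi> \<Longrightarrow> \<phi> = \<psi>"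
  by (rule lpa_hom_eqI) (auto simp: is_sigma_def)

lemma is_sigma_fixed: "is_sigma p \<phi> \<Longrightarrow> a \<in> A_subalg i1 i2 \<Longrightarrow> \<phi> a = a"
  by (rule lpa_hom_A_fixed[of \<phi> i2 i1]) (auto simp: is_sigma_def)

text \<open>Since \<phi> fixes \<open>q\<close>, the correction terms add up: the composite sends
  \<open>edge i2\<close> to \<open>edge i2 + edge i1 * p + edge i1 * q\<close>. In particular
  \<open>- p\<close> will give the inverse.\<close>

lemma is_sigma_comp:
  assumes "is_sigma p \<phi>" "is_sigma q \<psi>" "q \<in> A_subalg i1 i2"
  shows "is_sigma (p + q) (\<phi> \<circ> \<psi>)"
proof -
  have \<phi>: "lpa_hom \<phi>" using assms(1) by (simp add: is_sigma_def)
  show ?thesis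
    using assms(1,2) is_sigma_fixed[OF assms(1,3)] i1_neq_i2
    by (auto simp: is_sigma_def lpa_homD[OF \<phi>] lpa_hom_diff[OF \<phi>] lpa_hom_comp
        distrib_left distrib_right)
qed

lemma is_sigma_id: "is_sigma 0 (\<lambda>x. x)"
  by (simp add: is_sigma_def lpa_hom_def)

lemma is_sigma_exists: "\<exists>\<phi>. is_sigma (p :: ('k::field, 'n) lpa) \<phi>"
proof -
  define E where "E i = (if i = i2 then edge i2 + edge i1 * p else edge i)" for i
  define D where "D i = (if i = i1 then ghost i1 - p * ghost i2 else ghost i)" for i
  \<comment> \<open>The changes in \<open>edge i2\<close> and in \<open>ghost i1\<close> contribute
    the same term \<open>edge i1 * p * ghost i2\<close> with opposite signs, so the sum over the
    petals stays 1.\<close>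
  have "E i * D i = edge i * ghost i +
      ((if i = i2 then edge i1 * p * ghost i2 else 0) -
       (if i = i1 then edge i1 * p * ghost i2 else 0))" for i
    using i1_neq_i2 by (auto simp: E_def D_def algebra_simps)
  then have "(\<Sum>i\<in>UNIV. E i * D i) = (\<Sum>i\<in>UNIV. edge i * ghost i) +
      ((\<Sum>i\<in>UNIV. if i = i2 then edge i1 * p * ghost i2 else 0) -
       (\<Sum>i\<in>UNIV. if i = i1 then edge i1 * p * ghost i2 else 0))"
    by (simp only: sum.distrib sum_subtractf)
  also have "\<dots> = 1" by (simp add: edge_ghost_sum)
  finally have "(\<Sum>i\<in>UNIV. E i * D i) = 1" .
  moreover have "D i * E j = (if i = j then 1 else 0)" for i j
    using i1_neq_i2
    by (auto simp: E_def D_def distrib_left left_diff_distrib mult.assoc ghost_edge)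
      (simp_all add: ghost_edge flip: mult.assoc)
  ultimately show ?thesis
    using lpa_hom_exists[of D E] unfolding is_sigma_def E_def D_def by blast
qed

lemma is_sigma_inverse:
  assumes "is_sigma p \<phi>" "is_sigma (- p) \<psi>" "p \<in> A_subalg i1 i2"
  shows "\<phi> (\<psi> x) = x"
  using is_sigma_unique[OF is_sigma_comp[OF assms(1,2)], of "\<lambda>x. x"] is_sigma_id
    A_subalg_uminus[OF assms(3)] by (auto simp: fun_eq_iff)

lemma is_sigma_sigma:
  assumes p: "p \<in> A_subalg i1 i2"
  shows "is_sigma p (sigma i1 i2 p)"
proof -
  obtain \<phi> where \<phi>: "is_sigma p \<phi>" using is_sigma_exists by blast
  obtain \<psi> where \<psi>: "is_sigma (- p) \<psi>" using is_sigma_exists by blast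
  have inv: "\<phi> (\<psi> x) = x" "\<psi> (\<phi> x) = x" for x
    using is_sigma_inverse[OF \<phi> \<psi> p] is_sigma_inverse[OF \<psi> _ A_subalg_uminus[OF p], of \<phi>] \<phi>
    by simp_all
  have "bij \<phi>" by (rule o_bij[of \<psi>]) (auto simp: fun_eq_iff inv)
  have "sigma i1 i2 p = \<phi>"
    unfolding sigma_def
  proof (rule the_equality)
    show "lpa_automorphism \<phi> \<and> \<phi> (edge i2) = edge i2 + edge i1 * p \<and>
        \<phi> (ghost i1) = ghost i1 - p * ghost i2 \<and> (\<forall>a\<in>A_subalg i1 i2. \<phi> a = a)"
      using \<phi> \<open>bij \<phi>\<close> is_sigma_fixed[OF \<phi>]
      by (auto simp: is_sigma_def lpa_automorphism_def lpa_hom_def)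
  next
    fix \<tau> assume \<tau>: "lpa_automorphism \<tau> \<and> \<tau> (edge i2) = edge i2 + edge i1 * p \<and>
        \<tau> (ghost i1) = ghost i1 - p * ghost i2 \<and> (\<forall>a\<in>A_subalg i1 i2. \<tau> a = a)"
    have "\<tau> (edge i) = edge i" if "i \<noteq> i2" for i
      using \<tau> that by (auto simp: A_subalg_def intro: generated_subalg.gen)
    moreover have "\<tau> (ghost i) = ghost i" if "i \<noteq> i1" for i
      using \<tau> that by (auto simp: A_subalg_def intro: generated_subalg.gen)
    ultimately have "is_sigma p \<tau>"
      using \<tau> by (auto simp: is_sigma_def lpa_automorphism_def lpa_hom_def)
    then show "\<tau> = \<phi>" using \<phi> by (rule is_sigma_unique)
  qed
  with \<phi> show ?thesis by simp
qed

lemma sigma_comp: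
  assumes "p \<in> A_subalg i1 i2" "q \<in> A_subalg i1 i2"
  shows "sigma i1 i2 p (sigma i1 i2 q x) = sigma i1 i2 (p + q) x"
proof -
  have "sigma i1 i2 p \<circ> sigma i1 i2 q = sigma i1 i2 (p + q)"
    by (rule is_sigma_unique[OF is_sigma_comp[OF is_sigma_sigma[OF assms(1)]
          is_sigma_sigma[OF assms(2)] assms(2)] is_sigma_sigma[OF A_subalg_add[OF assms]]])
  then show ?thesis by (simp add: fun_eq_iff)
qed

lemma sigma_zero: "sigma i1 i2 0 x = x"
  by (simp add: is_sigma_unique[OF is_sigma_sigma[OF A_subalg_zero] is_sigma_id])

lemma sigma_uminus:
  assumes "p \<in> A_subalg i1 i2"
  shows "sigma i1 i2 p (sigma i1 i2 (- p) x) = x" "sigma i1 i2 (- p) (sigma i1 i2 p x) = x"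
  using assms A_subalg_uminus[OF assms] by (simp_all add: sigma_comp sigma_zero)

lemma lpa_hom_sigma: "p \<in> A_subalg i1 i2 \<Longrightarrow> lpa_hom (sigma i1 i2 p)"
  using is_sigma_sigma unfolding is_sigma_def by blast

lemma sigma_edge:
  "p \<in> A_subalg i1 i2 \<Longrightarrow>
    sigma i1 i2 p (edge i) = (if i = i2 then edge i2 + edge i1 * p else edge i)"
  using is_sigma_sigma unfolding is_sigma_def by blast

lemma sigma_ghost:
  "p \<in> A_subalg i1 i2 \<Longrightarrow>
    sigma i1 i2 p (ghost i) = (if i = i1 then ghost i1 - p * ghost i2 else ghost i)"
  using is_sigma_sigma unfolding is_sigma_def by blast

lemma surj_sigma: "p \<in> A_subalg i1 i2 \<Longrightarrow> surj (sigma i1 i2 p)"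
  by (rule surjI[of _ "sigma i1 i2 (- p)"]) (rule sigma_uminus)

end

section \<open>Simplicity and isomorphism of modules\<close>

definition left_ideal :: "'r::ring_1 set \<Rightarrow> bool" where
  "left_ideal J \<longleftrightarrow> 0 \<in> J \<and> (\<forall>x\<in>J. \<forall>y\<in>J. x + y \<in> J) \<and> (\<forall>r. \<forall>x\<in>J. r * x \<in> J)"

lemma left_ideal_principal: "left_ideal (left_principal a)"
proof -
  have "\<exists>t. 0 = t * a" by (rule exI[of _ 0]) simp
  moreover have "\<exists>t. r * a + s * a = t * a" for r s
    by (rule exI[of _ "r + s"]) (simp add: distrib_right)
  moreover have "\<exists>t. r * (s * a) = t * a" for r s
    by (rule exI[of _ "r * s"]) (simp add: mult.assoc)
  ultimately show ?thesis by (auto simp: left_ideal_def left_principal_def)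
qed

lemma left_idealD:
  assumes "left_ideal J"
  shows "0 \<in> J" "x \<in> J \<Longrightarrow> y \<in> J \<Longrightarrow> x + y \<in> J" "x \<in> J \<Longrightarrow> r * x \<in> J"
  using assms by (auto simp: left_ideal_def)

lemma left_ideal_uminus: "left_ideal J \<Longrightarrow> x \<in> J \<Longrightarrow> - x \<in> J"
  using left_idealD(3)[of J x "- 1"] by simp

lemma left_ideal_diff: "left_ideal J \<Longrightarrow> x \<in> J \<Longrightarrow> y \<in> J \<Longrightarrow> x - y \<in> J"
  using left_idealD(2)[of J x "- y"] left_ideal_uminus[of J y] by simp

lemma left_ideal_congD:
  assumes "left_ideal J" "x - y \<in> J"
  shows "x \<in> J \<longleftrightarrow> y \<in> J" "r * x - r * y \<in> J" "r * x \<in> J \<longleftrightarrow> r * y \<in> J"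
proof -
  have *: "x \<in> J \<longleftrightarrow> y \<in> J" if "x - y \<in> J" for x y
    using left_idealD(2)[OF assms(1) that, of y] left_ideal_diff[OF assms(1) _ that, of x] by auto
  show "x \<in> J \<longleftrightarrow> y \<in> J" using * assms(2) .
  show "r * x - r * y \<in> J"
    using left_idealD(3)[OF assms(1,2), of r] by (simp add: right_diff_distrib)
  then show "r * x \<in> J \<longleftrightarrow> r * y \<in> J" using * by blast
qed

lemma left_ideal_cong_trans: "left_ideal J \<Longrightarrow> x - y \<in> J \<Longrightarrow> y - z \<in> J \<Longrightarrow> x - z \<in> J"
  using left_idealD(2)[of J "x - y" "y - z"] by simp

lemma left_ideal_cong_sym: "left_ideal J \<Longrightarrow> x - y \<in> J \<Longrightarrow> y - x \<in> J"
  using left_ideal_uminus[of J "x - y"] by simp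

context
  fixes J :: "'r::ring_1 set"
  assumes J: "left_ideal J"
begin

lemma in_lcoset_iff: "x \<in> lcoset J a \<longleftrightarrow> x - a \<in> J"
  unfolding lcoset_def by (auto intro: exI[of _ "x - a"])

lemma lcoset_eq_iff: "lcoset J a = lcoset J b \<longleftrightarrow> a - b \<in> J"
proof
  assume "lcoset J a = lcoset J b"
  then have "a \<in> lcoset J b" using in_lcoset_iff[of a a] left_idealD(1)[OF J] by simp
  then show "a - b \<in> J" by (simp add: in_lcoset_iff)
next
  assume "a - b \<in> J"
  then show "lcoset J a = lcoset J b"
    using left_ideal_cong_trans[OF J] left_ideal_cong_sym[OF J] unfolding set_eq_iff in_lcoset_iff
    by blast
qed

lemma quot_module_simps:
  "mcarrier (quot_module J) = range (lcoset J)"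
  "mzero (quot_module J) = lcoset J 0"
  "madd (quot_module J) (lcoset J a) (lcoset J b) = lcoset J (a + b)"
  "msmult (quot_module J) r (lcoset J a) = lcoset J (r * a)"
proof -
  show "mcarrier (quot_module J) = range (lcoset J)" by (simp add: quot_module_def)
  show "mzero (quot_module J) = lcoset J 0" by (auto simp: quot_module_def in_lcoset_iff)
  have "{x + y |x y. x - a \<in> J \<and> y - b \<in> J} = {x. x - (a + b) \<in> J}"
  proof safe
    fix x y assume "x - a \<in> J" "y - b \<in> J"
    then show "x + y - (a + b) \<in> J"
      using left_idealD(2)[OF J, of "x - a" "y - b"] by (simp add: algebra_simps)
  next
    fix x assume "x - (a + b) \<in> J"
    then show "\<exists>x' y. x = x' + y \<and> x' - a \<in> J \<and> y - b \<in> J"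
      using left_idealD(1)[OF J] by (intro exI[of _ a] exI[of _ "x - a"]) (simp add: algebra_simps)
  qed
  then show "madd (quot_module J) (lcoset J a) (lcoset J b) = lcoset J (a + b)"
    by (auto simp: quot_module_def in_lcoset_iff)
  have "{r * x + j |x j. x - a \<in> J \<and> j \<in> J} = {x. x - r * a \<in> J}"
  proof safe
    fix x j assume "x - a \<in> J" "j \<in> J"
    then show "r * x + j - r * a \<in> J"
      using left_idealD(2)[OF J left_idealD(3)[OF J, of "x - a" r], of j] by (simp add: algebra_simps)
  next
    fix x assume "x - r * a \<in> J"
    then show "\<exists>x' j. x = r * x' + j \<and> x' - a \<in> J \<and> j \<in> J"
      using left_idealD(1)[OF J] by (intro exI[of _ a] exI[of _ "x - r * a"]) simp
  qed
  then show "msmult (quot_module J) r (lcoset J a) = lcoset J (r * a)"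
    by (auto simp: quot_module_def in_lcoset_iff)
qed

lemma left_module_quot: "left_module (quot_module J)"
proof
  fix X assume "X \<in> mcarrier (quot_module J)"
  then obtain a where "X = lcoset J a" by (auto simp: quot_module_simps)
  then show "\<exists>Y\<in>mcarrier (quot_module J). madd (quot_module J) Y X = mzero (quot_module J)"
    by (intro bexI[of _ "lcoset J (- a)"]) (simp_all add: quot_module_simps)
qed (auto simp: quot_module_simps algebra_simps)

text \<open>By \<open>max\<close> every nonzero coset has the coset of 1 among its multiples, and
  that coset generates the quotient.\<close>

lemma simple_quot_module:
  assumes "1 \<notin> J" and max: "\<And>a. a \<notin> J \<Longrightarrow> \<exists>r. r * a - 1 \<in> J"
  shows "simple_module (quot_module J)"
  unfolding simple_module_def
proof (intro conjI allI impI)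
  show "left_module (quot_module J)" by (rule left_module_quot)
  have "lcoset J 1 \<noteq> lcoset J 0" using assms(1) by (simp add: lcoset_eq_iff)
  then show "mcarrier (quot_module J) \<noteq> {mzero (quot_module J)}"
    unfolding quot_module_simps by blast
  fix N assume N: "submodule (quot_module J) N"
  show "N = {mzero (quot_module J)} \<or> N = mcarrier (quot_module J)"
  proof (rule disjCI)
    assume "N \<noteq> mcarrier (quot_module J)"
    have "X = lcoset J 0" if X: "X \<in> N" for X
    proof (rule ccontr)
      assume "X \<noteq> lcoset J 0"
      obtain a where a: "X = lcoset J a" using N X by (auto simp: submodule_def quot_module_simps)
      with \<open>X \<noteq> lcoset J 0\<close> have "a \<notin> J" by (simp add: lcoset_eq_iff)
      then obtain r where "r * a - 1 \<in> J" using max by blast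
      then have "lcoset J (r * a) = lcoset J 1" by (simp add: lcoset_eq_iff)
      moreover have smult: "msmult (quot_module J) t Y \<in> N" if "Y \<in> N" for t Y
        using N that by (simp add: submodule_def)
      ultimately have "lcoset J 1 \<in> N" using smult[OF X, of r] a by (simp add: quot_module_simps)
      from smult[OF this] have "lcoset J t \<in> N" for t by (simp add: quot_module_simps)
      then have "N = mcarrier (quot_module J)"
        using N by (auto simp: submodule_def quot_module_simps)
      with \<open>N \<noteq> mcarrier (quot_module J)\<close> show False ..
    qed
    moreover have "lcoset J 0 \<in> N" using N by (simp add: submodule_def quot_module_simps)
    ultimately show "N = {mzero (quot_module J)}" unfolding quot_module_simps by blast
  qed
qed

end

lemma twist_simps [simp]:
  "mcarrier (twist \<sigma> M) = mcarrier M" "madd (twist \<sigma> M) = madd M" "mzero (twist \<sigma> M) = mzero M"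
  "msmult (twist \<sigma> M) r = msmult M (\<sigma> r)"
  by (simp_all add: twist_def fun_eq_iff)

lemma left_module_twist:
  assumes "lpa_hom \<sigma>" "left_module M"
  shows "left_module (twist \<sigma> M)"
proof -
  interpret left_module M by (rule assms(2))
  show ?thesis
    by (unfold_locales; simp add: lpa_homD[OF assms(1)] zero_closed add_closed smult_closed
        add_assoc add_zero add_inverse smult_add add_smult smult_smult one_smult; rule add_comm)
qed

text \<open>By surjectivity, a set is closed under the twisted action exactly when it is closed
  under the original one, so the submodules are the same.\<close>

lemma simple_twist:
  assumes "lpa_hom \<sigma>" "surj \<sigma>" "simple_module M"
  shows "simple_module (twist \<sigma> M)"
proof -
  have "submodule (twist \<sigma> M) N \<longleftrightarrow> submodule M N" for N
  proof -
    have "(\<forall>r. P (\<sigma> r)) \<longleftrightarrow> (\<forall>r. P r)" for P using surjD[OF assms(2)] by metis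
    from this[of "\<lambda>r. \<forall>x\<in>N. msmult M r x \<in> N"] show ?thesis by (simp add: submodule_def)
  qed
  then show ?thesis
    using assms(3) left_module_twist[OF assms(1), of M] by (auto simp: simple_module_def)
qed

lemma (in left_module) smult_zero_left:
  assumes "x \<in> mcarrier M" shows "msmult M 0 x = mzero M"
proof -
  let ?z = "msmult M 0 x"
  have z: "?z \<in> mcarrier M" using assms by (rule smult_closed)
  obtain y where y: "y \<in> mcarrier M" "madd M y ?z = mzero M" using add_inverse[OF z] by blast
  have "madd M ?z ?z = ?z" unfolding add_smult[OF assms, symmetric] by simp
  then have "madd M y (madd M ?z ?z) = mzero M" using y(2) by simp
  then show ?thesis using add_assoc[OF y(1) z z] y add_zero[OF z] by simp
qed

text \<open>Every non-isomorphism below rests on this consequence: the image of a nonzero element is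
  nonzero and inherits its annihilator.\<close>

lemma iso_module_annihilator:
  assumes M: "left_module M" and N: "left_module N" and iso: "M \<cong>\<^sub>m N"
    and x: "x \<in> mcarrier M" "x \<noteq> mzero M"
  shows "\<exists>y\<in>mcarrier N. y \<noteq> mzero N \<and>
    (\<forall>r. msmult M r x = mzero M \<longrightarrow> msmult N r y = mzero N)"
proof -
  obtain h where h: "bij_betw h (mcarrier M) (mcarrier N)"
    "\<And>r x. x \<in> mcarrier M \<Longrightarrow> h (msmult M r x) = msmult N r (h x)"
    using iso unfolding iso_module_def by blast
  have closed: "h x \<in> mcarrier N" using h(1) x(1) by (auto simp: bij_betw_def)
  have h0: "h (mzero M) = mzero N"
    using h(2)[OF x(1), of 0] left_module.smult_zero_left[OF M x(1)]
      left_module.smult_zero_left[OF N closed] by simp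
  have "h x \<noteq> mzero N"
    using inj_onD[OF bij_betw_imp_inj_on[OF h(1)], of x "mzero M"] x
      left_module.zero_closed[OF M] h0 by auto
  moreover have "msmult N r (h x) = mzero N" if "msmult M r x = mzero M" for r
    using h(2)[OF x(1)] h0 that by metis
  ultimately show ?thesis using closed by blast
qed

text \<open>Here the element is the coset of 1, whose annihilator in the twist by \<sigma> is the
  preimage of \<open>J\<close>.\<close>

lemma quot_iso_annihilator:
  assumes J: "left_ideal J" "1 \<notin> J" and J': "left_ideal J'"
    and \<sigma>: "lpa_hom \<sigma>" and \<tau>: "lpa_hom \<tau>"
    and iso: "twist \<sigma> (quot_module J) \<cong>\<^sub>m twist \<tau> (quot_module J')"
  shows "\<exists>b. b \<notin> J' \<and> (\<forall>r. \<sigma> r \<in> J \<longrightarrow> \<tau> r * b \<in> J')"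
proof -
  have "lcoset J 1 \<in> mcarrier (twist \<sigma> (quot_module J))"
    "lcoset J 1 \<noteq> mzero (twist \<sigma> (quot_module J))"
    using J by (auto simp: quot_module_simps lcoset_eq_iff)
  from iso_module_annihilator[OF left_module_twist[OF \<sigma> left_module_quot[OF J(1)]]
      left_module_twist[OF \<tau> left_module_quot[OF J']] iso this]
  obtain b where "lcoset J' b \<noteq> lcoset J' 0"
    "\<And>r. lcoset J (\<sigma> r) = lcoset J 0 \<longrightarrow> lcoset J' (\<tau> r * b) = lcoset J' 0"
    using J(1) J' by (auto simp: quot_module_simps)
  then show ?thesis using J(1) J' by (auto simp: lcoset_eq_iff)
qed

section \<open>The left ideal generated by a polynomial in a simple closed path\<close>

lemma Irr_poly_pCons:
  assumes "f \<in> Irr_poly"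
  obtains h where "1 - [:0, 1:] * h = f" "h \<noteq> 0"
proof -
  obtain a g where f: "f = pCons a g" by (cases f) auto
  have "a = 1" using assms f by (simp add: Irr_poly_def)
  moreover have "g \<noteq> 0" using assms f \<open>a = 1\<close> by (auto simp: Irr_poly_def one_pCons[symmetric])
  \<comment> \<open>\<open>- g\<close> represents the inverse of x modulo \<open>f\<close>; it is
    nonzero because \<open>f\<close> is not the unit 1.\<close>
  ultimately have "1 - [:0, 1:] * (- g) = f" "- g \<noteq> 0" by (simp_all add: f one_pCons)
  then show ?thesis by (rule that)
qed

text \<open>Irreducibility makes the cofactor a constant, and the constant terms force it to be
  1.\<close>

lemma Irr_poly_dvd_eq:
  assumes f: "f \<in> Irr_poly" and g: "g \<in> Irr_poly" and "f dvd g"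
  shows "f = g"
proof -
  obtain h where h: "g = f * h" using \<open>f dvd g\<close> by blast
  have "h dvd 1" using f g h irreducibleD[of g f h] by (auto simp: Irr_poly_def irreducible_def)
  then obtain a where a: "h = [:a:]" by (metis is_unit_polyE)
  have "poly.coeff g 0 = poly.coeff f 0 * a" using h a by (simp add: mult.commute)
  then show ?thesis using f g h a by (simp add: Irr_poly_def one_pCons[symmetric])
qed

text \<open>Euclid's algorithm: an inverse of \<open>q\<close> comes from one of
  \<open>f mod q\<close>, which has smaller degree and, while \<open>q\<close> is not a unit, is
  nonzero by irreducibility. An arbitrary \<open>q\<close> is first reduced modulo
  \<open>f\<close>.\<close>

lemma Irr_poly_inverse:
  assumes "f \<in> Irr_poly" "\<not> f dvd q"
  obtains t where "f dvd 1 - t * q"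
proof -
  have f: "irreducible f" "f \<noteq> 0" using assms(1) by (auto simp: Irr_poly_def)
  have "\<exists>t. f dvd 1 - t * q" if "q \<noteq> 0" "Polynomial.degree q < Polynomial.degree f" for q
    using that
  proof (induction "Polynomial.degree q" arbitrary: q rule: less_induct)
    case less
    show ?case
    proof (cases "q dvd 1")
      case True
      then obtain t where "1 = q * t" by (rule dvdE)
      then show ?thesis by (intro exI[of _ t]) (simp add: mult.commute)
    next
      case False
      define r where "r = f mod q"
      have r: "r = f - (f div q) * q" by (simp add: r_def minus_div_mult_eq_mod)
      have "r \<noteq> 0"
      proof
        assume "r = 0"
        then have "f = (f div q) * q" using r by simp
        then have "f div q dvd 1" using irreducibleD[OF f(1)] False by blast
        then have "Polynomial.degree (f div q) = 0" by (auto elim: is_unit_polyE)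
        with \<open>f = (f div q) * q\<close> have "Polynomial.degree f \<le> Polynomial.degree q"
          by (metis add_0 degree_mult_le)
        with less.prems show False by simp
      qed
      moreover have "Polynomial.degree r < Polynomial.degree q"
        using \<open>r \<noteq> 0\<close> degree_mod_less[OF less.prems(1), of f] by (simp add: r_def)
      ultimately obtain t where "f dvd 1 - t * r" using less by fastforce
      then have "f dvd 1 - t * r + t * f" by simp
      also have "1 - t * r + t * f = 1 - (- t * (f div q)) * q"
        unfolding r by (simp add: algebra_simps)
      finally show ?thesis by (rule exI)
    qed
  qed
  moreover have "q mod f \<noteq> 0" using assms(2) by (simp add: mod_eq_0_iff_dvd)
  moreover from this have "Polynomial.degree (q mod f) < Polynomial.degree f"
    using degree_mod_less[OF f(2)] by blast
  ultimately obtain t where "f dvd 1 - t * (q mod f)" by blast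
  then have "f dvd (1 - t * (q mod f)) - t * (q div f) * f" by simp
  also have "(1 - t * (q mod f)) - t * (q div f) * f = 1 - t * (q div f * f + q mod f)"
    by (simp only: algebra_simps)
  finally show ?thesis by (intro that) simp
qed

subsection \<open>Properness\<close>

text \<open>
  The algebra acts on all functions \<open>\<int> \<times> R\<^sub>n\<^sup>\<infinity> \<rightarrow> K\<close>, edges raising the integer by one.
  A function carried by \<open>c\<^sup>\<infinity>\<close> is annihilated by \<open>f(c)\<close> when its values satisfy the linear
  recurrence given by \<open>f\<close>; a nonzero solution in both directions is read off the powers of
  the invertible class of \<open>x\<close> in \<open>K[x]/(f)\<close>.
\<close>

definition shift_op :: "'n gen \<Rightarrow> (int \<Rightarrow> 'n stream \<Rightarrow> 'k::field) \<Rightarrow> int \<Rightarrow> 'n stream \<Rightarrow> 'k" where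
  "shift_op g \<phi> k \<beta> = (case g of
     Edge i \<Rightarrow> if shd \<beta> = i then \<phi> (k - 1) (stl \<beta>) else 0
   | Ghost i \<Rightarrow> \<phi> (k + 1) (i ## \<beta>))"

lemma sum_fun_apply: "(\<Sum>i\<in>A. F i) k \<beta> = (\<Sum>i\<in>A. F i k \<beta>)"
  by (induction A rule: infinite_finite_induct) simp_all

interpretation shift: lpa_family "\<lambda>a (\<phi> :: int \<Rightarrow> 'n::finite stream \<Rightarrow> 'k::field) k \<beta>. a * \<phi> k \<beta>" shift_op
  by unfold_locales
    (auto simp: fun_eq_iff shift_op_def algebra_simps sum_fun_apply split: gen.splits)

text \<open>Without the integer coordinate \<open>path_elem c\<close> would fix the basis path
  \<open>cycle c\<close>, and \<open>f(c)\<close> would act on it as the scalar \<open>f(1)\<close>.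
  With it, \<open>path_elem c\<close> shifts the sequence \<open>b\<close> by the length of
  \<open>c\<close>.\<close>

definition on_cycle :: "'n list \<Rightarrow> (int \<Rightarrow> 'k::field) \<Rightarrow> int \<Rightarrow> 'n stream \<Rightarrow> 'k" where
  "on_cycle c b k \<beta> = (if \<beta> = cycle c then b k else 0)"

lemma shift_path_elem:
  "shift.lpa_op (path_elem w) \<phi> k \<beta> =
    (if stake (length w) \<beta> = w then \<phi> (k - int (length w)) (sdrop (length w) \<beta>) else 0)"
  by (induction w arbitrary: k \<beta>)
    (auto simp: shift.lpa_op_one shift.lpa_op_mult shift.lpa_op_edge shift_op_def algebra_simps)

lemma shift_on_cycle:
  assumes "c \<noteq> []"
  shows "shift.lpa_op (path_elem c) (on_cycle c b) = on_cycle c (\<lambda>k. b (k - int (length c)))"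
proof -
  have "stake (length c) \<beta> = c \<and> sdrop (length c) \<beta> = cycle c \<longleftrightarrow> \<beta> = cycle c" for \<beta>
    using assms cycle_decomp[of c] stake_sdrop[of "length c" \<beta>]
    by (auto simp: stake_cycle_eq sdrop_cycle_eq)
  then show ?thesis by (force simp: fun_eq_iff shift_path_elem on_cycle_def)
qed

lemma one_notin_principal_poly:
  assumes f: "f \<in> Irr_poly" and c: "c \<noteq> []"
  shows "1 \<notin> left_principal (poly_at f (path_elem c) :: ('k::field, 'n::finite) lpa)"
proof
  obtain h where h: "1 - [:0, 1:] * h = f" "h \<noteq> 0" using f by (rule Irr_poly_pCons)
  define m where "m = int (length c)"
  have m: "m > 0" using c by (simp add: m_def)
  \<comment> \<open>\<open>pw j\<close> represents the power \<open>x^j\<close> modulo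
    \<open>f\<close> for every integer \<open>j\<close>, with \<open>h\<close> as the inverse of
    x.\<close>
  define pw where "pw j = (if j \<ge> 0 then [:0, 1:] ^ nat j else h ^ nat (- j))" for j :: int
  have pw: "([:0, 1:] * pw j) mod f = pw (j + 1) mod f" for j
  proof (cases "j \<ge> 0")
    case True
    then have "[:0, 1:] * pw j = pw (j + 1)" by (simp add: pw_def nat_add_distrib del: mult_pCons_left)
    then show ?thesis by simp
  next
    case False
    define n where "n = nat (- j) - 1"
    have n: "nat (- j) = Suc n" "nat (- (j + 1)) = n" using False by (auto simp: n_def)
    have "pw (j + 1) = h ^ n"
      using False n by (cases "j = - 1") (auto simp: pw_def)
    moreover have "[:0, 1:] * pw j = ([:0, 1:] * h) * h ^ n"
      using False n by (simp add: pw_def mult.assoc del: mult_pCons_left)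
    ultimately have "pw (j + 1) - [:0, 1:] * pw j = f * h ^ n"
      unfolding h(1)[symmetric] by (simp only: left_diff_distrib mult_1)
    then show ?thesis by (metis dvd_triv_left mod_eq_dvd_iff)
  qed
  \<comment> \<open>Since \<open>k div m\<close> drops by one when \<open>k\<close> drops by
    \<open>m\<close>, a shift by \<open>m\<close> becomes multiplication of \<open>u\<close> by x.
    Hence \<open>f(c)\<close> will multiply \<open>u\<close> by \<open>f\<close>, which gives the
    zero sequence.\<close>
  define b where "b u k = poly.coeff ((u * pw (- (k div m))) mod f) 0" for u k
  have b_shift: "b u (k - m) = b ([:0, 1:] * u) k" for u k
  proof -
    have "(k - m) div m = k div m - 1" using m div_mult_self1[of m k "- 1"] by simp
    then have "- ((k - m) div m) = - (k div m) + 1" by simp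
    then have "(u * pw (- ((k - m) div m))) mod f = (u * (pw (- (k div m) + 1) mod f)) mod f"
      by (simp only: mod_mult_right_eq)
    also have "\<dots> = ([:0, 1:] * u * pw (- (k div m))) mod f"
      unfolding pw[symmetric] mod_mult_right_eq by (simp only: ac_simps)
    finally show ?thesis by (simp add: b_def)
  qed
  have add: "on_cycle c (b (u + v)) = on_cycle c (b u) + on_cycle c (b v)" for u v
    by (simp add: fun_eq_iff on_cycle_def b_def distrib_right poly_mod_add_left)
  have scalar: "on_cycle c (b (Polynomial.smult a u)) = (\<lambda>k \<beta>. a * on_cycle c (b u) k \<beta>)" for a u
    by (simp add: fun_eq_iff on_cycle_def b_def mod_smult_left)
  have act: "shift.lpa_op (poly_at q (path_elem c)) (on_cycle c (b u)) = on_cycle c (b (q * u))" for q u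
  proof (induction q arbitrary: u)
    case 0
    then show ?case using shift.lpa_op_scalar[of 0]
      by (simp add: fun_eq_iff on_cycle_def b_def)
  next
    case (pCons a q)
    have "shift.lpa_op (poly_at (pCons a q) (path_elem c)) (on_cycle c (b u)) =
        on_cycle c (b (Polynomial.smult a u)) + on_cycle c (b (q * ([:0, 1:] * u)))"
      using shift_on_cycle[OF c, of "b u"]
      by (simp add: poly_at_pCons shift.lpa_op_add_left shift.lpa_op_mult shift.lpa_op_scalar
          scalar b_shift[unfolded m_def] pCons.IH)
    also have "\<dots> = on_cycle c (b (pCons a q * u))"
      unfolding add[symmetric] by (simp add: algebra_simps)
    finally show ?case .
  qed
  have "b f k = 0" for k
    by (simp add: b_def)
  then have "shift.lpa_op (poly_at f (path_elem c)) (on_cycle c (b 1)) = 0"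
    unfolding act by (simp add: fun_eq_iff on_cycle_def)
  moreover assume "1 \<in> left_principal (poly_at f (path_elem c) :: ('k, 'n) lpa)"
  then obtain r where "r * poly_at f (path_elem c) = (1 :: ('k, 'n) lpa)"
    by (auto simp: left_principal_def)
  ultimately have "on_cycle c (b 1) = 0"
    by (metis shift.lpa_op_mult shift.lpa_op_one shift.lpa_op_zero)
  then have "b 1 0 = 0" by (metis on_cycle_def zero_fun_def)
  \<comment> \<open>As \<open>h\<close> is nonzero, \<open>f\<close> has positive degree, so the
    solution belonging to \<open>u = 1\<close> takes the value 1 at 0.\<close>
  moreover have "1 mod f = 1"
    using h by (intro mod_poly_less) (auto simp flip: h(1) simp: degree_pCons_eq one_pCons)
  then have "b 1 0 = 1" by (simp add: b_def pw_def)
  ultimately show False by simp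
qed

section \<open>Computation modulo the left ideal generated by \<open>f(c)\<close>\<close>

lemma stream_eq_stakeI:
  assumes "\<And>j. stake j s = stake j t"
  shows "s = t"
proof -
  have "s !! i = t !! i" for i
    using assms[of "Suc i"] by (metis lessI stake_nth)
  then show ?thesis using smap_alt[of id s t] by (simp add: stream.map_id)
qed

lemma poly_at_intertwine:
  assumes "y * t = t * x"
  shows "poly_at u y * t = t * poly_at u x"
  by (induction u)
     (simp_all add: poly_at_pCons distrib_left distrib_right mult.assoc assms lpa_scalar_commute[of _ t],
      simp flip: mult.assoc)

locale simple_cycle =
  fixes f :: "'k::field poly" and c :: "'n::finite list"
  assumes f_Irr: "f \<in> Irr_poly" and c_SCP: "c \<in> SCP"
begin

definition P :: "'k poly \<Rightarrow> ('k, 'n) lpa" where "P q = poly_at q (path_elem c)"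

definition J :: "('k, 'n) lpa set" where "J = left_principal (P f)"

lemma c_not_Nil: "c \<noteq> []"
  using c_SCP by (rule SCP_not_Nil)

lemma left_ideal_J: "left_ideal J"
  unfolding J_def by (rule left_ideal_principal)

lemmas J_zero = left_idealD(1)[OF left_ideal_J]
  and J_add = left_idealD(2)[OF left_ideal_J]
  and J_mult = left_idealD(3)[OF left_ideal_J]
  and J_trans = left_ideal_cong_trans[OF left_ideal_J]
  and J_sym = left_ideal_cong_sym[OF left_ideal_J]
  and J_congD = left_ideal_congD[OF left_ideal_J]

lemma one_notin_J: "1 \<notin> J"
  unfolding J_def P_def using f_Irr c_not_Nil by (rule one_notin_principal_poly)

lemma P_mult: "P (q * q') = P q * P q'"
  by (simp add: P_def poly_at_mult)

lemma P_commute: "P q * P q' = P q' * P q"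
  by (simp add: mult.commute flip: P_mult)

lemma P_one [simp]: "P 1 = 1"
  by (simp add: P_def)

lemma P_diff: "P (q - q') = P q - P q'"
  by (simp add: P_def poly_at_minus)

lemma P_f_in_J: "P f \<in> J"
  unfolding J_def left_principal_def by (auto intro: exI[of _ 1])

text \<open>\<open>J\<close> is only a left ideal, but polynomials in \<open>c\<close> commute with
  \<open>f(c)\<close>.\<close>

lemma J_mult_right: "a \<in> J \<Longrightarrow> a * P q \<in> J"
proof -
  assume "a \<in> J"
  then obtain r where "a = r * P f" by (auto simp: J_def left_principal_def)
  then have "a * P q = (r * P q) * P f" by (simp add: mult.assoc P_commute)
  then show ?thesis using J_mult[OF P_f_in_J] by simp
qed

text \<open>If \<open>f\<close> did not divide \<open>q\<close>, an inverse of \<open>q\<close>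
  modulo \<open>f\<close> would put 1 into \<open>J\<close>. Thus the field \<open>K[x]/(f)\<close>
  embeds into the quotient.\<close>

lemma P_in_J_iff: "P q \<in> J \<longleftrightarrow> f dvd q"
proof
  assume "f dvd q"
  then show "P q \<in> J" using J_mult_right[OF P_f_in_J] by (auto simp: P_mult elim!: dvdE)
next
  assume q: "P q \<in> J"
  show "f dvd q"
  proof (rule ccontr)
    assume "\<not> f dvd q"
    then obtain t where "f dvd 1 - t * q" using Irr_poly_inverse[OF f_Irr] by blast
    then obtain s where "1 - t * q = f * s" by (rule dvdE)
    then have "P (1 - t * q) = P f * P s" by (simp only: P_mult)
    then have "1 - P t * P q \<in> J" using J_mult_right[OF P_f_in_J] by (simp add: P_mult P_diff)
    then have "1 \<in> J" using J_congD(1) J_mult[OF q] by blast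
    then show False using one_notin_J by blast
  qed
qed

lemma inverse_mod_J:
  assumes "P q \<notin> J"
  obtains t where "P t * P q - 1 \<in> J"
proof -
  have "\<not> f dvd q" using assms P_in_J_iff by blast
  then obtain t where "f dvd 1 - t * q" using Irr_poly_inverse[OF f_Irr] by blast
  then have "P (1 - t * q) \<in> J" using P_in_J_iff by blast
  then have "1 - P t * P q \<in> J" by (simp add: P_mult P_diff)
  then show ?thesis by (rule that[OF J_sym])
qed

text \<open>As x is invertible modulo \<open>f\<close>, \<open>M\<close> copies of \<open>c\<close>
  can be split off on the left of any polynomial in \<open>c\<close>; \<open>u\<close> is the
  \<open>M\<close>-th power of the inverse.\<close>

lemma absorb:
  obtains u where "\<And>q. P q - path_elem (concat (replicate M c)) * P (u * q) \<in> J"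
proof -
  obtain h where h: "1 - [:0, 1:] * h = f" using f_Irr by (rule Irr_poly_pCons)
  have "f dvd 1 - ([:0, 1:] * h) ^ M"
    unfolding h[symmetric] one_diff_power_eq by (rule dvd_triv_left)
  then have "f dvd (1 - [:0, 1:] ^ M * h ^ M) * q" for q
    by (simp only: power_mult_distrib dvd_mult2)
  moreover have "P ((1 - [:0, 1:] ^ M * h ^ M) * q) =
      P q - path_elem (concat (replicate M c)) * P (h ^ M * q)" for q
  proof -
    have "P ([:0, 1:] ^ M) = path_elem (concat (replicate M c))"
      unfolding P_def poly_at_power poly_at_x path_elem_power ..
    then show ?thesis
      by (simp only: left_diff_distrib mult_1 P_diff mult.assoc P_mult)
  qed
  ultimately show ?thesis using P_in_J_iff by (intro that[of "h ^ M"]) metis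
qed

text \<open>Once \<open>absorb\<close> has prolonged the tail by enough copies of \<open>c\<close>
  to exceed the length of \<open>v\<close>, the ghost word either strips a matching prefix or gives
  0.\<close>

lemma ghost_path_prefix:
  assumes "ghost_path v * (path_elem t * P q) \<notin> J"
  shows "v = stake (length v) (t @- cycle c)"
proof -
  define y where "y = t @ concat (replicate (length v) c)"
  have cyc: "t @- cycle c = y @- cycle c"
  proof -
    have "concat (replicate m c) @- cycle c = cycle c" for m
      by (induction m) (use c_not_Nil in \<open>simp_all flip: cycle_decomp\<close>)
    then show ?thesis by (simp add: y_def)
  qed
  have len: "length v \<le> length y"
    using c_not_Nil by (simp add: y_def length_concat sum_list_replicate trans_le_add2 Suc_le_eq)
  obtain u where "P q - path_elem (concat (replicate (length v) c)) * P (u * q) \<in> J"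
    using absorb by blast
  from J_congD(2)[OF this, of "path_elem t"]
  have "path_elem t * P q - path_elem y * P (u * q) \<in> J"
    by (simp add: y_def path_elem_append mult.assoc)
  from J_congD(3)[OF this, of "ghost_path v"] assms
  have "ghost_path v * path_elem y * P (u * q) \<notin> J" by (simp add: mult.assoc)
  then have "ghost_path v * path_elem y \<noteq> (0 :: ('k, 'n) lpa)" using J_zero by auto
  then have "v = take (length v) y" using ghost_path_take[OF len] by metis
  then show ?thesis unfolding cyc using len by (simp add: stake_shift)
qed

text \<open>
  Long enough ghost words bring every element into \<open>tK[c]\<close> modulo the ideal, where \<open>t\<close> is a tail
  of \<open>c\<close>. The tail is determined by the last \<open>|c|\<close> letters of the ghost word, because \<open>c\<close> is
  simple; this makes the property stable under sums.
\<close>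

definition reduces :: "('k, 'n) lpa \<Rightarrow> 'n list \<Rightarrow> bool" where
  "reduces a w \<longleftrightarrow> ghost_path w * a \<in> J \<or> (\<exists>r q w'. r < length c \<and> w = w' @ rotate r c \<and>
     ghost_path w * a - path_elem (drop r c) * P q \<in> J)"

text \<open>If \<open>ghost_path w\<close> is not in \<open>J\<close>, then \<open>w\<close> is a
  prefix of \<open>cycle c\<close>. Writing 1 as \<open>j + 1\<close> copies of \<open>c\<close>
  times a polynomial, stripping \<open>w\<close> leaves the rest \<open>drop r c\<close> of the last
  copy.\<close>

lemma reduces_one:
  assumes "length c \<le> length w"
  shows "reduces 1 w"
proof (cases "ghost_path w \<in> J")
  case False
  define j where "j = length w div length c"
  define r where "r = length w mod length c"
  have r: "r < length c" using c_not_Nil by (simp add: r_def)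
  \<comment> \<open>At least one full turn lies in \<open>w\<close>; its last
    \<open>length c\<close> letters, which straddle that turn and the final \<open>take r c\<close>,
    spell \<open>rotate r c\<close>.\<close>
  obtain j' where j': "j = Suc j'"
    using assms c_not_Nil unfolding j_def by (metis div_greater_zero_iff gr0_conv_Suc length_greater_0_conv)
  have "w = stake (length w) (cycle c)"
    using ghost_path_prefix[of w "[]" 1] False by simp
  then have w: "w = concat (replicate j c) @ take r c"
    using c_not_Nil by (simp add: stake_cycle j_def r_def)
  have comm: "concat (replicate m c) @ c = c @ concat (replicate m c)" for m
    by (induction m) auto
  have "w = (concat (replicate j' c) @ take r c) @ rotate r c"
    using r by (simp add: w j' rotate_drop_take comm[symmetric])
  moreover have "ghost_path w - path_elem (drop r c) * P q \<in> J" if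
    "P 1 - path_elem (concat (replicate (Suc j) c)) * P (q * 1) \<in> J" for q
  proof -
    have "concat (replicate (Suc j) c) = w @ drop r c"
      by (simp add: w comm[symmetric])
    then have "ghost_path w * path_elem (concat (replicate (Suc j) c)) =
        (path_elem (drop r c) :: ('k, 'n) lpa)"
      by (simp only: path_elem_append ghost_path_path_elem_self)
    then show ?thesis
      using J_congD(2)[OF that, of "ghost_path w"] by (simp del: replicate.simps flip: mult.assoc)
  qed
  ultimately show ?thesis using absorb[of "Suc j"] r unfolding reduces_def by (metis mult_1_right)
qed (simp add: reduces_def)

lemma reduces_add:
  assumes "reduces a w" "reduces b w"
  shows "reduces (a + b) w"
proof -
  consider "ghost_path w * a \<in> J" | "ghost_path w * b \<in> J"
    | "ghost_path w * a \<notin> J" "ghost_path w * b \<notin> J" by blast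
  then show ?thesis
  proof cases
    case 1
    then have "ghost_path w * (a + b) - ghost_path w * b \<in> J" by (simp add: distrib_left)
    then show ?thesis using assms(2) J_congD(1) J_trans unfolding reduces_def by blast
  next
    case 2
    then have "ghost_path w * (a + b) - ghost_path w * a \<in> J" by (simp add: distrib_left)
    then show ?thesis using assms(1) J_congD(1) J_trans unfolding reduces_def by blast
  next
    case 3
    then obtain r q w' s q' w'' where
      a: "r < length c" "w = w' @ rotate r c" "ghost_path w * a - path_elem (drop r c) * P q \<in> J" and
      b: "s < length c" "w = w'' @ rotate s c" "ghost_path w * b - path_elem (drop s c) * P q' \<in> J"
      using assms unfolding reduces_def by blast
    \<comment> \<open>Both rotations are the last \<open>length c\<close> letters of the same
      \<open>w\<close>.\<close>
    have "rotate r c = rotate s c" using a(2) b(2) by (metis append_eq_append_conv length_rotate)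
    then have "r = s" using rotate_SCP_inj[OF c_SCP a(1) b(1)] by blast
    then have "ghost_path w * (a + b) - path_elem (drop r c) * P (q + q') \<in> J"
      using J_add[OF a(3) b(3)] by (simp add: P_def poly_at_add algebra_simps)
    then show ?thesis using a unfolding reduces_def by blast
  qed
qed

lemma reduces_scalar:
  assumes "reduces a w"
  shows "reduces (lpa_scalar k * a) w"
proof -
  have 1: "ghost_path w * (lpa_scalar k * a) = lpa_scalar k * (ghost_path w * a)"
    by (simp add: lpa_scalar_commute[of k "ghost_path w"] flip: mult.assoc)
  have "ghost_path w * (lpa_scalar k * a) - path_elem t * P (Polynomial.smult k q) =
      lpa_scalar k * (ghost_path w * a - path_elem t * P q)" for t q
    unfolding 1 P_def poly_at_smult right_diff_distrib
    by (simp add: lpa_scalar_commute[of k "path_elem t"] flip: mult.assoc)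
  then show ?thesis using assms J_mult 1 unfolding reduces_def by metis
qed

text \<open>The edge meets the first letter of \<open>w\<close>, which cancels it or gives 0. One
  letter is used up, hence the bound \<open>Suc N\<close>.\<close>

lemma reduces_edge:
  assumes "\<And>w. N \<le> length w \<Longrightarrow> reduces a w" "Suc N \<le> length w"
  shows "reduces (edge i * a) w"
proof -
  obtain j v where w: "w = j # v" using assms(2) by (cases w) auto
  have 1: "ghost_path w * (edge i * a) = (if i = j then ghost_path v * a else 0)"
  proof -
    have "ghost_path w * (edge i * a) = ghost_path v * (ghost j * edge i) * a"
      by (simp add: w mult.assoc)
    then show ?thesis by (auto simp: ghost_edge)
  qed
  have "reduces a v" using assms w by simp
  then show ?thesis
    using J_zero unfolding reduces_def 1 by (auto simp: w)
qed

text \<open>The ghost edge prolongs the word at the front; \<open>length c \<le> length w\<close>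
  keeps the window of the last \<open>length c\<close> letters inside \<open>w\<close>
  itself.\<close>

lemma reduces_ghost:
  assumes "\<And>w. N \<le> length w \<Longrightarrow> reduces a w" "max N (length c) \<le> length w"
  shows "reduces (ghost i * a) w"
proof -
  have 1: "ghost_path w * (ghost i * a) = ghost_path (i # w) * a"
    by (simp add: mult.assoc)
  have "reduces a (i # w)" using assms by simp
  then consider "ghost_path (i # w) * a \<in> J" | r q w' where "r < length c" "i # w = w' @ rotate r c"
    "ghost_path (i # w) * a - path_elem (drop r c) * P q \<in> J"
    unfolding reduces_def by blast
  then show ?thesis
  proof cases
    case 2
    have "w' \<noteq> []" using assms(2) 2(2) by (metis Suc_n_not_le_n append_Nil length_Cons length_rotate max.boundedE)
    then have "w = tl w' @ rotate r c" using 2(2) by (cases w') auto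
    then show ?thesis using 2 unfolding reduces_def 1 by blast
  qed (simp only: reduces_def 1 simp_thms)
qed

lemma eventually_reduces: "\<exists>N. \<forall>w. N \<le> length w \<longrightarrow> reduces a w"
proof (induction a rule: lpa_induct)
  case one
  show ?case using reduces_one by blast
next
  case (scalar k x)
  then show ?case using reduces_scalar by blast
next
  case (add x y)
  then obtain M N where "\<forall>w. M \<le> length w \<longrightarrow> reduces x w" "\<forall>w. N \<le> length w \<longrightarrow> reduces y w"
    by blast
  then show ?case by (intro exI[of _ "max M N"]) (simp add: reduces_add)
next
  case (edge i x)
  then show ?case using reduces_edge by metis
next
  case (ghost i x)
  then show ?case using reduces_ghost by metis
qed

text \<open>As the products \<open>edge i * ghost i\<close> sum to 1, the ghost edges cannot all
  send an element outside \<open>J\<close> into \<open>J\<close>.\<close>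

lemma notin_J_descends:
  assumes "a \<notin> J"
  obtains w where "length w = N" "ghost_path w * a \<notin> J"
proof -
  have "\<exists>w. length w = N \<and> ghost_path w * a \<notin> J" for N
  proof (induction N)
    case 0
    then show ?case using assms by simp
  next
    case (Suc N)
    then obtain w where w: "length w = N" "ghost_path w * a \<notin> J" by blast
    have "\<exists>i. ghost i * (ghost_path w * a) \<notin> J"
    proof (rule ccontr)
      assume "\<not> ?thesis"
      then have "edge i * (ghost i * (ghost_path w * a)) \<in> J" for i using J_mult by blast
      then have "(\<Sum>i\<in>A. edge i * (ghost i * (ghost_path w * a))) \<in> J" for A
        by (induction A rule: infinite_finite_induct) (auto intro: J_zero J_add)
      from this[of UNIV] show False
        using w edge_ghost_sum[where 'k = 'k and 'n = 'n]
        by (simp flip: mult.assoc sum_distrib_right)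
    qed
    then obtain i where "ghost i * (ghost_path w * a) \<notin> J" by blast
    then show ?case using w by (intro exI[of _ "w @ [i]"]) (simp add: ghost_path_append mult.assoc)
  qed
  then show ?thesis using that by blast
qed

section \<open>Simplicity of the quotient, and elements concentrated on an infinite path\<close>

lemma simple_quot_J: "simple_module (quot_module J)"
proof (rule simple_quot_module[OF left_ideal_J one_notin_J])
  fix a assume a: "a \<notin> J"
  obtain N where N: "\<And>w. N \<le> length w \<Longrightarrow> reduces a w" using eventually_reduces by blast
  obtain w where w: "length w = N" "ghost_path w * a \<notin> J" using notin_J_descends[OF a] .
  then obtain r q where rq: "ghost_path w * a - path_elem (drop r c) * P q \<in> J"
    using N[of w] unfolding reduces_def by auto
  then have "P q \<notin> J" using w(2) J_congD(1) J_mult by blast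
  then obtain t where t: "P t * P q - 1 \<in> J" by (rule inverse_mod_J)
  \<comment> \<open>The ghost word strips the tail that is left, and \<open>P t\<close> inverts the
    remaining polynomial.\<close>
  have "P t * ghost_path (drop r c) * (ghost_path w * a) - P t * P q \<in> J"
    using J_congD(2)[OF rq, of "P t * ghost_path (drop r c)"] by (simp add: mult.assoc)
  from J_trans[OF this t] show "\<exists>r. r * a - 1 \<in> J" by (metis mult.assoc)
qed

text \<open>For large \<open>k\<close> a tail of \<open>c\<close> times a polynomial remains.
  Stripping further along \<gamma> never enters \<open>J\<close>, so
  \<open>ghost_path_prefix\<close> forces the rest of \<gamma> to run along that tail and then along
  copies of \<open>c\<close>.\<close>

lemma concentrated_tail:
  assumes "\<And>k. ghost_path (stake k \<gamma>) * a \<notin> J"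
  obtains N where "\<And>k. N \<le> k \<Longrightarrow> \<exists>r q. r < length c \<and> P q \<notin> J \<and>
    sdrop k \<gamma> = sdrop r (cycle c) \<and> ghost_path (stake k \<gamma>) * a - path_elem (drop r c) * P q \<in> J"
proof -
  obtain N where N: "\<And>w. N \<le> length w \<Longrightarrow> reduces a w" using eventually_reduces by blast
  show ?thesis
  proof (rule that[of N])
    fix k assume "N \<le> k"
    then have "reduces a (stake k \<gamma>)" using N by simp
    then obtain r q where r: "r < length c" and
      rq: "ghost_path (stake k \<gamma>) * a - path_elem (drop r c) * P q \<in> J"
      using assms unfolding reduces_def by blast
    have "P q \<notin> J" using rq assms J_congD(1) J_mult by blast
    moreover have "sdrop k \<gamma> = sdrop r (cycle c)"
    proof (rule stream_eq_stakeI)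
      fix j
      let ?v = "stake j (sdrop k \<gamma>)"
      have "stake (k + j) \<gamma> = stake k \<gamma> @ ?v" by (simp add: stake_add)
      then have "ghost_path ?v * (ghost_path (stake k \<gamma>) * a) \<notin> J"
        using assms[of "k + j"] by (simp only: ghost_path_append mult.assoc not_False_eq_True)
      then have "ghost_path ?v * (path_elem (drop r c) * P q) \<notin> J"
        using J_congD(3)[OF rq] by blast
      from ghost_path_prefix[OF this] show "?v = stake j (sdrop r (cycle c))"
        by (simp add: sdrop_cycle_less(1)[OF r])
    qed
    ultimately show "\<exists>r q. r < length c \<and> P q \<notin> J \<and> sdrop k \<gamma> = sdrop r (cycle c) \<and>
        ghost_path (stake k \<gamma>) * a - path_elem (drop r c) * P q \<in> J"
      using r rq by blast
  qed
qed

lemma concentrated_tail_equiv: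
  assumes "a \<notin> J" and "\<And>k. (1 - path_elem (stake k \<gamma>) * ghost_path (stake k \<gamma>)) * a \<in> J"
  shows "tail_equiv \<gamma> (cycle c)"
proof -
  have "ghost_path (stake k \<gamma>) * a \<notin> J" for k
  proof
    assume "ghost_path (stake k \<gamma>) * a \<in> J"
    from J_add[OF assms(2)[of k] J_mult[OF this, of "path_elem (stake k \<gamma>)"]] assms(1)
    show False by (simp add: left_diff_distrib mult.assoc)
  qed
  then obtain N where N: "\<And>k. N \<le> k \<Longrightarrow> \<exists>r q. r < length c \<and> P q \<notin> J \<and>
    sdrop k \<gamma> = sdrop r (cycle c) \<and> ghost_path (stake k \<gamma>) * a - path_elem (drop r c) * P q \<in> J"
    using concentrated_tail by blast
  then obtain r where "sdrop (Suc N) \<gamma> = sdrop r (cycle c)" by (meson le_SucI order_refl)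
  \<comment> \<open>\<open>tail_equiv\<close> asks for positive numbers of dropped letters, while
    \<open>r\<close> may be 0; so a full turn is dropped in addition.\<close>
  also have "sdrop r (cycle c) = sdrop (length c + r) (cycle c)"
    using c_not_Nil by (simp add: sdrop_add[symmetric] sdrop_cycle_eq)
  finally show ?thesis using c_not_Nil unfolding tail_equiv_def by (metis add_gr_0 length_greater_0_conv zero_less_Suc)
qed

text \<open>Modulo \<open>J\<close>, 1 is a product beginning with \<open>k\<close> copies of
  \<open>c\<close>. These contain at least \<open>k\<close> letters, so they begin with the prefix
  in question, and the projection onto that prefix fixes them.\<close>

lemma concentrated_generator: "1 - path_elem (stake k (cycle c)) * ghost_path (stake k (cycle c)) \<in> J"
proof -
  define w where "w = stake k (cycle c)"
  obtain v where v: "concat (replicate k c) = w @ v"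
  proof -
    have "concat (replicate k c) = stake (k * length c) (cycle c)"
      using c_not_Nil by (simp add: stake_cycle_eq_mod_0)
    also have "\<dots> = w @ stake (k * length c - k) (sdrop k (cycle c))"
      using c_not_Nil unfolding w_def stake_add by (simp add: Suc_le_eq)
    finally show ?thesis by (rule that)
  qed
  obtain u where "P 1 - path_elem (concat (replicate k c)) * P (u * 1) \<in> J"
    using absorb by blast
  from J_mult[OF this, of "1 - path_elem w * ghost_path w"]
  show ?thesis by (simp add: w_def[symmetric] v path_elem_append left_diff_distrib right_diff_distrib mult.assoc)
qed

end

text \<open>Being annihilated by the ideal of \<open>g(d)\<close>, \<open>a\<close> is concentrated
  on \<open>cycle d\<close>, which makes \<open>d\<close> a rotation of \<open>c\<close>. Across the
  tail \<open>drop r c\<close>, \<open>g(d)\<close> becomes \<open>g(c)\<close>; then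
  \<open>f\<close> divides \<open>g * q\<close> but not \<open>q\<close>, and \<open>f\<close> is
  prime.\<close>

lemma simple_cycle_annihilated:
  fixes f g :: "'k::field poly" and c d :: "'n::finite list"
  assumes "f \<in> Irr_poly" "c \<in> SCP" "g \<in> Irr_poly" "d \<in> SCP"
    and a: "a \<notin> left_principal (poly_at f (path_elem c) :: ('k, 'n) lpa)"
    and ann: "\<And>s. s \<in> left_principal (poly_at g (path_elem d)) \<Longrightarrow>
      s * a \<in> left_principal (poly_at f (path_elem c))"
  shows "g = f \<and> rotations d = rotations c"
proof -
  interpret C: simple_cycle f c using assms by unfold_locales
  interpret D: simple_cycle g d using assms by unfold_locales
  have a: "a \<notin> C.J" using a by (simp add: C.J_def C.P_def)
  have ann: "s * a \<in> C.J" if "s \<in> D.J" for s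
    using ann that by (simp add: C.J_def C.P_def D.J_def D.P_def)
  have "ghost_path (stake k (cycle d)) * a \<notin> C.J" for k
  proof
    assume "ghost_path (stake k (cycle d)) * a \<in> C.J"
    from C.J_add[OF ann[OF D.concentrated_generator[of k]] C.J_mult[OF this, of "path_elem (stake k (cycle d))"]] a
    show False by (simp add: left_diff_distrib mult.assoc)
  qed
  then obtain N where N: "\<And>k. N \<le> k \<Longrightarrow> \<exists>r q. r < length c \<and> C.P q \<notin> C.J \<and>
      sdrop k (cycle d) = sdrop r (cycle c) \<and>
      ghost_path (stake k (cycle d)) * a - path_elem (drop r c) * C.P q \<in> C.J"
    using C.concentrated_tail by blast
  \<comment> \<open>At a multiple of \<open>length d\<close> the stripped prefix is a power of
    \<open>d\<close> and the rest is again \<open>cycle d\<close>.\<close>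
  define k where "k = N * length d"
  have "N \<le> k" using D.c_not_Nil by (simp add: k_def Suc_le_eq)
  from N[OF this] obtain r q where r: "r < length c" "C.P q \<notin> C.J"
    "sdrop k (cycle d) = sdrop r (cycle c)"
    "ghost_path (stake k (cycle d)) * a - path_elem (drop r c) * C.P q \<in> C.J" by blast
  have "cycle d = cycle (rotate r c)"
    using r(3) D.c_not_Nil by (simp add: sdrop_cycle_less(2)[OF r(1)] k_def sdrop_cycle_eq_mod_0)
  then have d: "d = rotate r c" using cycle_inj_SCP[OF assms(4) rotate_SCP[OF assms(2)]] by blast
  have stake: "stake k (cycle d) = concat (replicate N d)"
    using D.c_not_Nil by (simp add: k_def stake_cycle_eq_mod_0)
  \<comment> \<open>The ghost word is congruent to a polynomial \<open>u(d)\<close>, which commutes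
    with \<open>g(d)\<close>; so \<open>g(d)\<close> also annihilates what is left of
    \<open>a\<close>.\<close>
  obtain u where "D.P 1 - path_elem (concat (replicate N d)) * D.P (u * 1) \<in> D.J"
    using D.absorb by blast
  from D.J_congD(2)[OF this, of "ghost_path (concat (replicate N d))"]
  have "ghost_path (concat (replicate N d)) - D.P u \<in> D.J" by simp
  from ann[OF this] have "D.P u * a - path_elem (drop r c) * C.P q \<in> C.J"
    using C.J_trans[OF C.J_sym r(4)] by (simp add: left_diff_distrib stake)
  moreover have "D.P g * (D.P u * a) \<in> C.J"
    using ann[OF D.J_mult_right[OF D.P_f_in_J, of u]] by (simp add: mult.assoc)
  ultimately have "D.P g * (path_elem (drop r c) * C.P q) \<in> C.J"
    using C.J_congD(3) by blast
  moreover have "D.P g * path_elem (drop r c) = path_elem (drop r c) * C.P g"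
    unfolding D.P_def C.P_def
  proof (rule poly_at_intertwine)
    show "path_elem d * path_elem (drop r c) = (path_elem (drop r c) * path_elem c :: ('k, 'n) lpa)"
      using r(1) by (simp add: d rotate_drop_take flip: path_elem_append)
  qed
  ultimately have "path_elem (drop r c) * C.P (g * q) \<in> C.J"
    by (simp add: C.P_mult flip: mult.assoc)
  from C.J_mult[OF this, of "ghost_path (drop r c)"] have "f dvd g * q"
    by (simp add: C.P_in_J_iff)
  moreover have "\<not> f dvd q" using r(2) C.P_in_J_iff by blast
  moreover have "prime_elem f" using assms(1) by (simp add: Irr_poly_def field_poly_irreducible_imp_prime)
  ultimately have "f dvd g" by (simp add: prime_elem_dvd_mult_iff)
  then have "f = g" using Irr_poly_dvd_eq assms(1,3) by blast
  then show ?thesis using d rotations_rotate[OF r(1)] by simp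
qed

section \<open>Concentrated elements and stable ideals under the automorphisms\<close>

context petal_pair
begin

lemma twisted_concentrated:
  fixes f :: "'k::field poly" and p :: "('k, 'n) lpa"
  assumes "f \<in> Irr_poly" "d \<in> SCP" and last: "last d = i2" and p: "p \<in> A_subalg i1 i2"
    and a: "a \<notin> left_principal (poly_at f (path_elem d))"
    and conc: "\<And>k. sigma i1 i2 p (1 - path_elem (stake k \<gamma>) * ghost_path (stake k \<gamma>)) * a \<in>
      left_principal (poly_at f (path_elem d))"
  shows "p \<in> left_principal (poly_at f (path_elem d))"
proof -
  interpret D: simple_cycle f d using assms by unfold_locales
  have J: "left_principal (poly_at f (path_elem d)) = D.J" by (simp add: D.J_def D.P_def)
  define \<sigma> where "\<sigma> = sigma i1 i2 p"
  note hom = lpa_homD[OF lpa_hom_sigma[OF p], folded \<sigma>_def]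
  \<comment> \<open>\<open>m k\<close> is what remains of \<open>a\<close> when the first
    \<open>k\<close> letters of \<gamma> are stripped in the twisted module.\<close>
  define m where "m k = \<sigma> (ghost_path (stake k \<gamma>)) * a" for k
  have m: "\<sigma> (path_elem (stake k \<gamma>)) * m k - a \<in> D.J" for k
  proof -
    have "(1 - \<sigma> (path_elem (stake k \<gamma>)) * \<sigma> (ghost_path (stake k \<gamma>))) * a \<in> D.J"
      using conc[of k] unfolding J \<sigma>_def[symmetric] lpa_hom_diff[OF lpa_hom_sigma[OF p], folded \<sigma>_def] hom .
    then have "a - \<sigma> (path_elem (stake k \<gamma>)) * m k \<in> D.J"
      by (simp add: m_def left_diff_distrib mult.assoc)
    then show ?thesis by (rule D.J_sym)
  qed
  have step: "m k - \<sigma> (edge (\<gamma> !! k)) * m (Suc k) \<in> D.J" for k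
  proof -
    have "\<sigma> (ghost_path (stake k \<gamma>)) * (\<sigma> (path_elem (stake (Suc k) \<gamma>)) * m (Suc k)) - m k \<in> D.J"
      unfolding m_def[of k] by (rule D.J_congD(2)[OF m])
    moreover have "\<sigma> (ghost_path (stake k \<gamma>)) * (\<sigma> (path_elem (stake (Suc k) \<gamma>)) * m (Suc k)) =
        \<sigma> (ghost_path (stake k \<gamma>) * path_elem (stake (Suc k) \<gamma>)) * m (Suc k)"
      by (simp only: hom mult.assoc)
    moreover have "ghost_path (stake k \<gamma>) * path_elem (stake (Suc k) \<gamma>) = (edge (\<gamma> !! k) :: ('k, 'n) lpa)"
      unfolding stake_Suc path_elem_append by simp
    ultimately have "\<sigma> (edge (\<gamma> !! k)) * m (Suc k) - m k \<in> D.J" by simp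
    then show ?thesis by (rule D.J_sym)
  qed
  have m_Suc: "m (Suc k) = \<sigma> (ghost (\<gamma> !! k)) * m k" for k
    unfolding m_def stake_Suc ghost_path_append by (simp add: hom mult.assoc)
  \<comment> \<open>Only \<open>ghost i1\<close> is altered, by \<open>p * ghost i2\<close>. When
    the letter is \<open>i1\<close>, \<open>m k\<close> is congruent to a multiple of
    \<open>edge i1\<close> from the left, which \<open>ghost i2\<close> kills.\<close>
  have "m (Suc k) - ghost (\<gamma> !! k) * m k \<in> D.J" for k
  proof (cases "\<gamma> !! k = i1")
    case True
    have "ghost i2 * m k - ghost i2 * (edge i1 * m (Suc k)) \<in> D.J"
      using D.J_congD(2)[OF step[of k], of "ghost i2"] True i1_neq_i2 by (simp add: \<sigma>_def sigma_edge[OF p])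
    then have "ghost i2 * m k \<in> D.J"
      using i1_neq_i2 by (simp add: ghost_edge flip: mult.assoc)
    then have "- (p * (ghost i2 * m k)) \<in> D.J"
      using left_ideal_uminus[OF D.left_ideal_J D.J_mult] by blast
    then show ?thesis
      using True by (simp add: m_Suc \<sigma>_def sigma_ghost[OF p] left_diff_distrib mult.assoc)
  next
    case False
    then show ?thesis using D.J_zero by (simp add: m_Suc \<sigma>_def sigma_ghost[OF p])
  qed
  note m_Suc' = this
  have m_ghost: "m k - ghost_path (stake k \<gamma>) * a \<in> D.J" for k
  proof (induction k)
    case 0
    then show ?case using D.J_zero by (simp add: m_def hom)
  next
    case (Suc k)
    from D.J_trans[OF m_Suc' D.J_congD(2)[OF this]] show ?case
      unfolding stake_Suc ghost_path_append by (simp add: mult.assoc)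
  qed
  have "m k \<notin> D.J" for k
    using D.J_congD(1)[OF m[of k]] D.J_mult[of "m k"] a unfolding J by blast
  then have "ghost_path (stake k \<gamma>) * a \<notin> D.J" for k
    using D.J_congD(1)[OF m_ghost[of k]] by blast
  then obtain N where N: "\<And>k. N \<le> k \<Longrightarrow> \<exists>r q. r < length d \<and> D.P q \<notin> D.J \<and>
      sdrop k \<gamma> = sdrop r (cycle d) \<and>
      ghost_path (stake k \<gamma>) * a - path_elem (drop r d) * D.P q \<in> D.J"
    using D.concentrated_tail by blast
  from N[of N] obtain r where r: "r < length d" "sdrop N \<gamma> = sdrop r (cycle d)" by blast
  \<comment> \<open>\<open>e\<close> is the position of the final letter \<open>i2\<close> of
    \<open>d\<close>, and \<open>k\<close> is chosen so that what remains of \<gamma> starts at that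
    position.\<close>
  define e where "e = length d - 1"
  define k where "k = N + (e - r)"
  have e: "e < length d" "drop e d = [i2]"
  proof -
    have "drop e (butlast d @ [last d]) = [last d]" by (simp add: e_def)
    then show "drop e d = [i2]" using append_butlast_last_id[OF D.c_not_Nil] last by metis
  qed (use r(1) in \<open>simp add: e_def\<close>)
  have sdrop_k: "sdrop k \<gamma> = sdrop e (cycle d)"
  proof -
    have "sdrop k \<gamma> = sdrop (e - r) (sdrop r (cycle d))"
      by (simp only: k_def r(2) flip: sdrop_add)
    also have "\<dots> = sdrop e (cycle d)" using r(1) by (simp add: e_def sdrop_add)
    finally show ?thesis .
  qed
  obtain s q where s: "s < length d" "D.P q \<notin> D.J" "sdrop k \<gamma> = sdrop s (cycle d)"
      "ghost_path (stake k \<gamma>) * a - path_elem (drop s d) * D.P q \<in> D.J"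
    using N[of k] by (auto simp: k_def)
  have "cycle (rotate s d) = cycle (rotate e d)"
    using s(3) sdrop_k sdrop_cycle_less(2)[OF s(1)] sdrop_cycle_less(2)[OF e(1)] by simp
  then have "s = e"
    using cycle_inj_SCP[OF rotate_SCP rotate_SCP] rotate_SCP_inj assms(2) s(1) e(1) by blast
  have mk: "m k - edge i2 * D.P q \<in> D.J"
    using D.J_trans[OF m_ghost s(4)] by (simp add: \<open>s = e\<close> e(2))
  have "\<gamma> !! k = shd (sdrop e (cycle d))" by (metis sdrop_k sdrop_simps(1))
  then have \<gamma>k: "\<gamma> !! k = i2" using sdrop_cycle_less(1)[OF e(1)] e(2) by simp
  have mSk: "m (Suc k) - D.P q \<in> D.J"
    using D.J_trans[OF m_Suc'[of k] D.J_congD(2)[OF mk, of "ghost (\<gamma> !! k)"]]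
    by (simp add: \<gamma>k ghost_edge flip: mult.assoc)
  \<comment> \<open>\<open>m k\<close> is congruent to \<open>D.P q\<close> preceded by the plain
    edge and also by the twisted edge; the difference is \<open>edge i1 * p * D.P q\<close>.\<close>
  have "edge i2 * D.P q - (edge i2 + edge i1 * p) * D.P q \<in> D.J"
    using D.J_trans[OF D.J_sym[OF mk] D.J_trans[OF step[of k] D.J_congD(2)[OF mSk]]]
    by (simp add: \<gamma>k \<sigma>_def sigma_edge[OF p])
  then have "- (edge i1 * (p * D.P q)) \<in> D.J" by (simp add: distrib_right mult.assoc)
  from D.J_mult[OF left_ideal_uminus[OF D.left_ideal_J this], of "ghost i1"]
  have pq: "p * D.P q \<in> D.J" by (simp add: ghost_edge flip: mult.assoc)
  \<comment> \<open>\<open>D.P q\<close> is invertible modulo the ideal by a polynomial in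
    \<open>d\<close>, so \<open>p\<close> itself lies in the ideal.\<close>
  obtain t where "D.P t * D.P q - 1 \<in> D.J" using s(2) by (rule D.inverse_mod_J)
  from D.J_congD(3)[OF this, of p] D.J_mult_right[OF pq, of t]
  show ?thesis unfolding J by (simp add: mult.assoc D.P_commute)
qed

text \<open>The petal \<open>i2\<close> occurs in \<open>d\<close> only at the end, so the
  automorphism changes \<open>path_elem d\<close> by a left multiple of \<open>p\<close>. This
  change lies in the ideal and stays there under right multiplication by polynomials in
  \<open>d\<close>.\<close>

lemma sigma_ideal_subset:
  fixes f :: "'k::field poly" and p :: "('k, 'n) lpa"
  assumes "f \<in> Irr_poly" "d \<in> C_s i2" and p: "p \<in> A_subalg i1 i2"
    and pJ: "p \<in> left_principal (poly_at f (path_elem d))"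
    and s: "s \<in> left_principal (poly_at f (path_elem d))"
  shows "sigma i1 i2 p s \<in> left_principal (poly_at f (path_elem d))"
proof -
  interpret D: simple_cycle f d using assms by unfold_locales (simp_all add: C_s_SCP)
  have J: "left_principal (poly_at f (path_elem d)) = D.J" by (simp add: D.J_def D.P_def)
  define \<sigma> where "\<sigma> = sigma i1 i2 p"
  note hom = lpa_homD[OF lpa_hom_sigma[OF p], folded \<sigma>_def]
  have "\<sigma> (path_elem w) = path_elem w" if "i2 \<notin> set w" for w
    using that by (induction w) (auto simp: hom, simp add: \<sigma>_def sigma_edge[OF p])
  then have "\<sigma> (path_elem (butlast d)) = path_elem (butlast d)"
    using assms(2) by (auto simp: C_s_def)
  moreover have "\<sigma> (edge i2) = edge i2 + edge i1 * p"
    by (simp add: \<sigma>_def sigma_edge[OF p])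
  ultimately have "\<sigma> (path_elem (butlast d @ [i2])) =
      path_elem (butlast d @ [i2]) + path_elem (butlast d) * edge i1 * p"
    by (simp add: path_elem_append hom distrib_left mult.assoc)
  moreover have "butlast d @ [i2] = d"
    using D.c_not_Nil assms(2) append_butlast_last_id[of d] by (simp add: C_s_def)
  ultimately have \<sigma>d: "\<sigma> (path_elem d) = path_elem d + path_elem (butlast d) * edge i1 * p"
    by simp
  \<comment> \<open>The arbitrary factor \<open>q\<close> on the right lets the induction absorb one
    power of \<open>d\<close> at a time.\<close>
  have "\<sigma> (D.P u) * D.P q - D.P (u * q) \<in> D.J" for u q
  proof (induction u arbitrary: q)
    case 0
    then show ?case using D.J_zero by (simp add: D.P_def hom)
  next
    case (pCons b u)
    have "p * D.P q \<in> D.J" using pJ D.J_mult_right unfolding J by blast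
    then have "\<sigma> (path_elem d) * D.P q - path_elem d * D.P q \<in> D.J"
      using D.J_mult[of _ "path_elem (butlast d) * edge i1"] by (simp add: \<sigma>d distrib_right mult.assoc)
    moreover have "path_elem d * D.P q = D.P ([:0, 1:] * q)"
      by (simp only: D.P_def poly_at_mult poly_at_x)
    ultimately have "\<sigma> (D.P u) * (\<sigma> (path_elem d) * D.P q) - \<sigma> (D.P u) * D.P ([:0, 1:] * q) \<in> D.J"
      using D.J_congD(2) by metis
    from D.J_trans[OF this pCons.IH]
    have "\<sigma> (D.P u) * (\<sigma> (path_elem d) * D.P q) - D.P (u * ([:0, 1:] * q)) \<in> D.J" .
    moreover have "\<sigma> (D.P (pCons b u)) * D.P q =
        lpa_scalar b * D.P q + \<sigma> (D.P u) * (\<sigma> (path_elem d) * D.P q)"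
      by (simp add: D.P_def poly_at_pCons hom distrib_right mult.assoc)
    moreover have "D.P (pCons b u * q) = lpa_scalar b * D.P q + D.P (u * ([:0, 1:] * q))"
      by (simp add: D.P_def poly_at_add poly_at_smult)
    ultimately show ?case by simp
  qed
  from this[of f 1] have "\<sigma> (D.P f) \<in> D.J"
    using D.J_congD(1) D.P_f_in_J by simp
  moreover obtain r where "s = r * D.P f" using s by (auto simp: D.P_def left_principal_def)
  ultimately show ?thesis unfolding J \<sigma>_def[symmetric] using D.J_mult by (simp add: hom)
qed

end

section \<open>The modules of infinite paths\<close>

lemma path_act_vscale: "path_act r (vscale a \<phi>) = vscale a (path_act r \<phi>)"
  by transfer (rule free_act_vscale)

lemma path_act_single_edge:
  "path_act (edge i) (Poly_Mapping.single \<beta> a) = Poly_Mapping.single (i ## \<beta>) a"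
  using path_act_vscale[of "edge i" a "Poly_Mapping.single \<beta> 1"]
  by (simp add: vscale_single path_act_edge)

lemma path_act_single_ghost:
  "path_act (ghost i) (Poly_Mapping.single \<beta> a) =
    (if shd \<beta> = i then Poly_Mapping.single (stl \<beta>) a else 0)"
  using path_act_vscale[of "ghost i" a "Poly_Mapping.single \<beta> 1"]
  by (simp add: vscale_single path_act_ghost)

lemma path_act_scalar: "path_act (lpa_scalar a) \<phi> = vscale a \<phi>"
  by transfer (simp add: free_act_single)

lemma path_act_zero [simp]: "path_act r 0 = 0"
  using path_act_add[of r 0 0] by simp

lemma path_act_diff: "path_act (r - s) \<phi> = path_act r \<phi> - path_act s \<phi>"
  using path_act_add_left[of "r - s" s \<phi>] by simp

lemma lookup_path_act_edge:
  "Poly_Mapping.lookup (path_act (edge i) \<phi>) \<beta> =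
    (if shd \<beta> = i then Poly_Mapping.lookup \<phi> (stl \<beta>) else 0)"
proof (induction \<phi> rule: single_induct)
  case (single \<alpha> a)
  show ?case by (cases \<beta>) (auto simp: path_act_single_edge lookup_single when_def)
qed (simp_all add: path_act_add lookup_add)

lemma lookup_path_act_ghost:
  "Poly_Mapping.lookup (path_act (ghost i) \<phi>) \<beta> = Poly_Mapping.lookup \<phi> (i ## \<beta>)"
proof (induction \<phi> rule: single_induct)
  case (single \<alpha> a)
  show ?case by (cases \<alpha>) (auto simp: path_act_single_ghost lookup_single when_def)
qed (simp_all add: path_act_add lookup_add)

lemma lookup_path_act_path_elem:
  "Poly_Mapping.lookup (path_act (path_elem w) \<phi>) \<beta> =
    (if stake (length w) \<beta> = w then Poly_Mapping.lookup \<phi> (sdrop (length w) \<beta>) else 0)"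
  by (induction w arbitrary: \<beta>) (auto simp: path_act_one path_act_mult lookup_path_act_edge)

lemma lookup_path_act_ghost_path:
  "Poly_Mapping.lookup (path_act (ghost_path w) \<phi>) \<beta> = Poly_Mapping.lookup \<phi> (w @- \<beta>)"
  by (induction w arbitrary: \<phi>) (auto simp: path_act_one path_act_mult lookup_path_act_ghost)

text \<open>The operator is the projection onto the paths that share the first \<open>k\<close>
  letters of \<alpha>.\<close>

lemma lookup_path_act_range:
  "Poly_Mapping.lookup (path_act (path_elem (stake k \<alpha>) * ghost_path (stake k \<alpha>)) \<phi>) \<beta> =
    (if stake k \<beta> = stake k \<alpha> then Poly_Mapping.lookup \<phi> \<beta> else 0)"
  by (auto simp: path_act_mult lookup_path_act_path_elem lookup_path_act_ghost_path
      stake_sdrop dest: sym[of "stake k \<beta>"])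

section \<open>Tail equivalence and the module structure on a tail class\<close>

lemma tail_equiv_refl: "tail_equiv \<alpha> \<alpha>"
  unfolding tail_equiv_def by (intro exI[of _ 1]) simp

lemma tail_equiv_sym: "tail_equiv \<alpha> \<beta> \<Longrightarrow> tail_equiv \<beta> \<alpha>"
  unfolding tail_equiv_def by metis

lemma tail_equiv_trans:
  assumes "tail_equiv \<alpha> \<beta>" "tail_equiv \<beta> \<gamma>"
  shows "tail_equiv \<alpha> \<gamma>"
proof -
  obtain m l m' l' where *: "0 < m" "0 < l" "sdrop m \<alpha> = sdrop l \<beta>"
    "0 < m'" "0 < l'" "sdrop m' \<beta> = sdrop l' \<gamma>"
    using assms unfolding tail_equiv_def by blast
  have "sdrop (m + m') \<alpha> = sdrop m' (sdrop l \<beta>)" by (simp only: *(3) flip: sdrop_add)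
  also have "\<dots> = sdrop l (sdrop m' \<beta>)" by (simp add: sdrop_add add.commute)
  also have "\<dots> = sdrop (l' + l) \<gamma>" by (simp only: *(6) sdrop_add)
  finally show ?thesis using * unfolding tail_equiv_def by (metis add_gr_0)
qed

lemma tail_equiv_SCons: "tail_equiv \<beta> (i ## \<beta>)"
  unfolding tail_equiv_def by (intro exI[of _ 1] exI[of _ 2]) (simp add: numeral_2_eq_2)

lemma tail_class_eqI: "tail_equiv \<alpha> \<beta> \<Longrightarrow> tail_class \<alpha> = tail_class \<beta>"
  unfolding tail_class_def using tail_equiv_trans tail_equiv_sym by blast

lemma SCons_in_tail_class_iff: "i ## \<beta> \<in> tail_class \<alpha> \<longleftrightarrow> \<beta> \<in> tail_class \<alpha>"
  using tail_equiv_trans[of \<alpha> \<beta> "i ## \<beta>"] tail_equiv_trans[of \<alpha> "i ## \<beta>" \<beta>]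
    tail_equiv_SCons[of \<beta> i] tail_equiv_sym[OF tail_equiv_SCons[of \<beta> i]]
  by (auto simp: tail_class_def)

lemma V_module_simps [simp]:
  "mcarrier (V_module C) = {\<phi>. Poly_Mapping.keys \<phi> \<subseteq> C}" "madd (V_module C) = (+)"
  "mzero (V_module C) = 0" "msmult (V_module C) = path_act"
  by (simp_all add: V_module_def)

lemma keys_subset_iff: "Poly_Mapping.keys \<phi> \<subseteq> C \<longleftrightarrow> (\<forall>\<beta>. \<beta> \<notin> C \<longrightarrow> Poly_Mapping.lookup \<phi> \<beta> = 0)"
  by (auto simp: in_keys_iff)

lemma keys_path_act:
  assumes "Poly_Mapping.keys \<phi> \<subseteq> tail_class \<alpha>"
  shows "Poly_Mapping.keys (path_act r \<phi>) \<subseteq> tail_class \<alpha>"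
proof -
  have stl: "stl \<beta> \<in> tail_class \<alpha> \<longleftrightarrow> \<beta> \<in> tail_class \<alpha>" for \<beta>
    using SCons_in_tail_class_iff[of "shd \<beta>" "stl \<beta>" \<alpha>] by simp
  show ?thesis
    using assms unfolding keys_subset_iff
    by (induction r rule: lpa_induct)
      (simp_all add: path_act_one path_act_mult path_act_scalar path_act_add_left lookup_add
        lookup_path_act_edge lookup_path_act_ghost stl SCons_in_tail_class_iff)
qed

lemma left_module_V: "left_module (V_module (tail_class \<alpha>) :: (('k::field, 'n::finite) lpa, _) lmod)"
proof
  fix \<phi> :: "'n stream \<Rightarrow>\<^sub>0 'k"
  assume "\<phi> \<in> mcarrier (V_module (tail_class \<alpha>))"
  then show "\<exists>\<psi>\<in>mcarrier (V_module (tail_class \<alpha>)).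
      madd (V_module (tail_class \<alpha>) :: (('k, 'n) lpa, _) lmod) \<psi> \<phi> =
      mzero (V_module (tail_class \<alpha>) :: (('k, 'n) lpa, _) lmod)"
    by (intro bexI[of _ "- \<phi>"]) (simp_all add: keys_subset_iff)
next
  fix \<phi> \<psi> :: "'n stream \<Rightarrow>\<^sub>0 'k"
  assume "\<phi> \<in> mcarrier (V_module (tail_class \<alpha>))" "\<psi> \<in> mcarrier (V_module (tail_class \<alpha>))"
  then show "madd (V_module (tail_class \<alpha>)) \<phi> \<psi> \<in> mcarrier (V_module (tail_class \<alpha>))"
    by (simp add: keys_subset_iff lookup_add)
qed (simp_all add: keys_path_act path_act_add path_act_add_left path_act_mult path_act_one ac_simps)

section \<open>Simplicity of the path modules and isomorphisms from them\<close>

lemma separating_prefix: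
  assumes "finite A"
  shows "\<exists>k. \<forall>\<gamma>\<in>A. stake k \<gamma> = stake k \<beta> \<longrightarrow> \<gamma> = \<beta>"
  using assms
proof (induction A rule: finite_induct)
  case (insert \<gamma> A)
  then obtain k where k: "\<forall>\<gamma>\<in>A. stake k \<gamma> = stake k \<beta> \<longrightarrow> \<gamma> = \<beta>" by blast
  obtain j where j: "\<gamma> \<noteq> \<beta> \<longrightarrow> stake j \<gamma> \<noteq> stake j \<beta>" using stream_eq_stakeI[of \<gamma> \<beta>] by blast
  have "stake j \<delta> = stake j \<beta>" "stake k \<delta> = stake k \<beta>" if "stake (max j k) \<delta> = stake (max j k) \<beta>" for \<delta>
    using arg_cong[OF that, of "take j"] arg_cong[OF that, of "take k"]
    by (simp_all add: take_stake min_def max_def split: if_splits)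
  then show ?case using j k by (intro exI[of _ "max j k"]) blast
qed simp

lemma simple_V: "simple_module (V_module (tail_class \<alpha>) :: (('k::field, 'n::finite) lpa, _) lmod)"
  unfolding simple_module_def
proof (intro conjI allI impI)
  show "left_module (V_module (tail_class \<alpha>) :: (('k, 'n) lpa, _) lmod)" by (rule left_module_V)
  have "Poly_Mapping.single \<alpha> (1 :: 'k) \<noteq> mzero (V_module (tail_class \<alpha>) :: (('k, 'n) lpa, _) lmod)"
    unfolding V_module_simps by (metis lookup_single_eq lookup_zero zero_neq_one)
  moreover have "Poly_Mapping.single \<alpha> (1 :: 'k) \<in>
      mcarrier (V_module (tail_class \<alpha>) :: (('k, 'n) lpa, _) lmod)"
    by (simp add: tail_class_def tail_equiv_refl)
  ultimately show "mcarrier (V_module (tail_class \<alpha>) :: (('k, 'n) lpa, _) lmod) \<noteq>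
      {mzero (V_module (tail_class \<alpha>))}"
    by blast
  fix N :: "('n stream \<Rightarrow>\<^sub>0 'k) set"
  assume N: "submodule (V_module (tail_class \<alpha>)) N"
  then have sub: "\<phi> \<in> N \<Longrightarrow> Poly_Mapping.keys \<phi> \<subseteq> tail_class \<alpha>"
    and zero: "0 \<in> N" and add: "\<phi> \<in> N \<Longrightarrow> \<psi> \<in> N \<Longrightarrow> \<phi> + \<psi> \<in> N"
    and act: "\<phi> \<in> N \<Longrightarrow> path_act r \<phi> \<in> N" for \<phi> \<psi> r
    by (auto simp: submodule_def)
  show "N = {mzero (V_module (tail_class \<alpha>))} \<or> N = mcarrier (V_module (tail_class \<alpha>))"
  proof (rule disjCI)
    assume "N \<noteq> mcarrier (V_module (tail_class \<alpha>))"
    have "\<phi> = 0" if \<phi>: "\<phi> \<in> N" for \<phi>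
    proof (rule ccontr)
      assume "\<phi> \<noteq> 0"
      then obtain \<beta> where \<beta>: "Poly_Mapping.lookup \<phi> \<beta> \<noteq> 0" by (metis poly_mapping_eqI lookup_zero)
      \<comment> \<open>On the finite support of \<phi> a long enough prefix of \<beta> singles out
        \<beta>, so stripping it leaves a multiple of one basis path.\<close>
      obtain k where k: "\<forall>\<gamma>\<in>Poly_Mapping.keys \<phi>. stake k \<gamma> = stake k \<beta> \<longrightarrow> \<gamma> = \<beta>"
        using separating_prefix[OF finite_keys] by blast
      define a where "a = Poly_Mapping.lookup \<phi> \<beta>"
      have "path_act (ghost_path (stake k \<beta>)) \<phi> = Poly_Mapping.single (sdrop k \<beta>) a"
      proof (rule poly_mapping_eqI)
        fix \<gamma>
        have "\<gamma> = sdrop k \<beta>" if "stake k \<beta> @- \<gamma> \<in> Poly_Mapping.keys \<phi>"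
        proof -
          have "stake k (stake k \<beta> @- \<gamma>) = stake k \<beta>" by (simp add: stake_shift)
          then have "stake k \<beta> @- \<gamma> = \<beta>" using k that by blast
          then have "sdrop k (stake k \<beta> @- \<gamma>) = sdrop k \<beta>" by simp
          then show ?thesis by (simp add: sdrop_shift)
        qed
        then show "Poly_Mapping.lookup (path_act (ghost_path (stake k \<beta>)) \<phi>) \<gamma> =
            Poly_Mapping.lookup (Poly_Mapping.single (sdrop k \<beta>) a) \<gamma>"
          by (auto simp: lookup_path_act_ghost_path lookup_single when_def a_def stake_sdrop in_keys_iff)
      qed
      then have "Poly_Mapping.single (sdrop k \<beta>) a \<in> N" using act[OF \<phi>] by metis
      from act[OF this, of "lpa_scalar (b / a)" for b]
      have 1: "Poly_Mapping.single (sdrop k \<beta>) b \<in> N" for b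
        using \<beta> by (simp add: path_act_scalar vscale_single a_def)
      have 2: "Poly_Mapping.single \<delta> b \<in> N" if "\<delta> \<in> tail_class \<alpha>" for \<delta> b
      proof -
        have "\<beta> \<in> tail_class \<alpha>" using sub[OF \<phi>] \<beta> by (auto simp: in_keys_iff)
        then have "tail_equiv \<delta> \<beta>"
          using that tail_equiv_trans[OF tail_equiv_sym] by (simp add: tail_class_def)
        then obtain m l where ml: "sdrop m \<delta> = sdrop l \<beta>" unfolding tail_equiv_def by blast
        have "sdrop l (sdrop k \<beta>) = sdrop k (sdrop l \<beta>)" by (simp add: sdrop_add add.commute)
        also have "\<dots> = sdrop (m + k) \<delta>" by (simp only: ml[symmetric] sdrop_add)
        finally have drop: "sdrop l (sdrop k \<beta>) = sdrop (m + k) \<delta>" .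
        \<comment> \<open>Ghost edges strip \<open>l\<close> more letters, down to a tail shared
          with \<delta>; edges then put the first \<open>m + k\<close> letters of \<delta> in
          front.\<close>
        have "path_act (path_elem (stake (m + k) \<delta>) * ghost_path (stake l (sdrop k \<beta>)))
            (Poly_Mapping.single (sdrop k \<beta>) b) = Poly_Mapping.single \<delta> b"
        proof (rule poly_mapping_eqI)
          fix \<gamma>
          have "stake (m + k) \<gamma> = stake (m + k) \<delta> \<and>
              sdrop k \<beta> = stake l (sdrop k \<beta>) @- sdrop (m + k) \<gamma> \<longleftrightarrow> \<delta> = \<gamma>"
          proof
            assume *: "stake (m + k) \<gamma> = stake (m + k) \<delta> \<and>
              sdrop k \<beta> = stake l (sdrop k \<beta>) @- sdrop (m + k) \<gamma>"
            then have "sdrop l (sdrop k \<beta>) = sdrop l (stake l (sdrop k \<beta>) @- sdrop (m + k) \<gamma>)" by simp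
            also have "\<dots> = sdrop (m + k) \<gamma>" by (simp add: sdrop_shift)
            finally show "\<delta> = \<gamma>" using * drop by (metis stake_sdrop)
          next
            assume "\<delta> = \<gamma>"
            then show "stake (m + k) \<gamma> = stake (m + k) \<delta> \<and>
              sdrop k \<beta> = stake l (sdrop k \<beta>) @- sdrop (m + k) \<gamma>"
              by (metis drop stake_sdrop)
          qed
          then show "Poly_Mapping.lookup (path_act (path_elem (stake (m + k) \<delta>) *
              ghost_path (stake l (sdrop k \<beta>))) (Poly_Mapping.single (sdrop k \<beta>) b)) \<gamma> =
              Poly_Mapping.lookup (Poly_Mapping.single \<delta> b) \<gamma>"
            by (auto simp: path_act_mult lookup_path_act_path_elem lookup_path_act_ghost_path
                lookup_single when_def simp del: sdrop_add)
        qed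
        then show ?thesis using act[OF 1] by metis
      qed
      \<comment> \<open>Setting \<open>g\<close> to 0 outside the class lets the induction run over
        all finitely supported functions.\<close>
      define g where "g \<delta> = (if \<delta> \<in> tail_class \<alpha> then Poly_Mapping.single \<delta> 1 else 0 :: 'n stream \<Rightarrow>\<^sub>0 'k)" for \<delta>
      have "lin_ext g \<psi> \<in> N" for \<psi>
        by (induction \<psi> rule: single_induct) (auto simp: g_def zero vscale_single 2 lin_ext_add add)
      moreover have "lin_ext (\<lambda>\<delta>. Poly_Mapping.single \<delta> 1) \<psi> = \<psi>" for \<psi> :: "'n stream \<Rightarrow>\<^sub>0 'k"
        by (induction \<psi> rule: single_induct) (auto simp: vscale_single lin_ext_add)
      moreover have "lin_ext g \<psi> = lin_ext (\<lambda>\<delta>. Poly_Mapping.single \<delta> 1) \<psi>"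
        if "Poly_Mapping.keys \<psi> \<subseteq> tail_class \<alpha>" for \<psi>
        unfolding lin_ext_def using that by (intro sum.cong) (auto simp: g_def)
      ultimately have "\<psi> \<in> N" if "Poly_Mapping.keys \<psi> \<subseteq> tail_class \<alpha>" for \<psi>
        using that by metis
      then have "N = mcarrier (V_module (tail_class \<alpha>))"
        using sub unfolding V_module_simps by blast
      with \<open>N \<noteq> mcarrier (V_module (tail_class \<alpha>))\<close> show False ..
    qed
    then show "N = {mzero (V_module (tail_class \<alpha>))}" using zero unfolding V_module_simps by blast
  qed
qed

text \<open>Concentration on \<alpha> is expressed by annihilation, the form in which an isomorphism
  carries it over.\<close>

lemma V_iso_annihilator:
  fixes N :: "(('k::field, 'n::finite) lpa, 'm) lmod"
  assumes "left_module N" "V_module (tail_class \<alpha>) \<cong>\<^sub>m N"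
  shows "\<exists>y\<in>mcarrier N. y \<noteq> mzero N \<and>
    (\<forall>k. msmult N (1 - path_elem (stake k \<alpha>) * ghost_path (stake k \<alpha>)) y = mzero N)"
proof -
  let ?x = "Poly_Mapping.single \<alpha> (1 :: 'k)"
  have "?x \<in> mcarrier (V_module (tail_class \<alpha>) :: (('k, 'n) lpa, _) lmod)"
    by (simp add: tail_class_def tail_equiv_refl)
  moreover have "?x \<noteq> mzero (V_module (tail_class \<alpha>) :: (('k, 'n) lpa, _) lmod)"
    by simp (metis lookup_single_eq lookup_zero zero_neq_one)
  ultimately obtain y where y: "y \<in> mcarrier N" "y \<noteq> mzero N"
    "\<And>r. path_act r ?x = 0 \<Longrightarrow> msmult N r y = mzero N"
    using iso_module_annihilator[OF left_module_V assms] by force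
  have "path_act (1 - path_elem (stake k \<alpha>) * ghost_path (stake k \<alpha>)) ?x = 0" for k
    by (rule poly_mapping_eqI)
      (auto simp: path_act_diff path_act_one lookup_minus lookup_path_act_range lookup_single when_def)
  then show ?thesis using y by blast
qed

text \<open>A path in the support of an element concentrated on \<alpha> shares every prefix with
  \<alpha>, hence equals \<alpha>; so \<alpha> lies in the class of \<beta>.\<close>

lemma V_iso_V:
  assumes "(V_module (tail_class \<alpha>) :: (('k::field, 'n::finite) lpa, _) lmod) \<cong>\<^sub>m V_module (tail_class \<beta>)"
  shows "tail_class \<alpha> = tail_class \<beta>"
proof -
  obtain y :: "'n stream \<Rightarrow>\<^sub>0 'k" where y: "Poly_Mapping.keys y \<subseteq> tail_class \<beta>" "y \<noteq> 0"
    "\<And>k. path_act (1 - path_elem (stake k \<alpha>) * ghost_path (stake k \<alpha>)) y = 0"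
    using V_iso_annihilator[OF left_module_V assms] by auto
  obtain \<delta> where \<delta>: "Poly_Mapping.lookup y \<delta> \<noteq> 0" using y(2) by (metis poly_mapping_eqI lookup_zero)
  have "stake k \<delta> = stake k \<alpha>" for k
  proof (rule ccontr)
    assume "stake k \<delta> \<noteq> stake k \<alpha>"
    then have "Poly_Mapping.lookup (path_act (1 - path_elem (stake k \<alpha>) * ghost_path (stake k \<alpha>)) y) \<delta> =
        Poly_Mapping.lookup y \<delta>"
      by (simp add: path_act_diff path_act_one lookup_minus lookup_path_act_range)
    then show False using y(3) \<delta> by simp
  qed
  then have "\<delta> = \<alpha>" by (rule stream_eq_stakeI)
  then have "\<alpha> \<in> tail_class \<beta>" using y(1) \<delta> by (auto simp: in_keys_iff)
  then show ?thesis by (metis tail_class_eqI tail_equiv_sym tail_class_def mem_Collect_eq)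
qed

lemma V_iso_quot:
  fixes J :: "('k::field, 'n::finite) lpa set"
  assumes "lpa_hom \<sigma>" "left_ideal J" "V_module (tail_class \<alpha>) \<cong>\<^sub>m twist \<sigma> (quot_module J)"
  obtains b where "b \<notin> J"
    "\<And>k. \<sigma> (1 - path_elem (stake k \<alpha>) * ghost_path (stake k \<alpha>)) * b \<in> J"
proof -
  obtain y where "y \<in> mcarrier (quot_module J)" "y \<noteq> mzero (quot_module J)"
    "\<And>k. msmult (quot_module J) (\<sigma> (1 - path_elem (stake k \<alpha>) * ghost_path (stake k \<alpha>))) y =
      mzero (quot_module J)"
    using V_iso_annihilator[OF left_module_twist[OF assms(1) left_module_quot[OF assms(2)]] assms(3)]
    by auto
  moreover from this(1) obtain b where "y = lcoset J b"
    using assms(2) by (auto simp: quot_module_simps)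
  ultimately show ?thesis
    using that[of b] by (simp add: quot_module_simps[OF assms(2)] lcoset_eq_iff[OF assms(2)])
qed

section \<open>Comparison of the three families\<close>

lemma twist_id: "twist (\<lambda>r. r) M = M"
  by (simp add: twist_def)

lemma lpa_hom_id: "lpa_hom (\<lambda>r. r)"
  by (simp add: lpa_hom_def)

lemma equiv_class_eqI:
  assumes "p - q \<in> left_principal (poly_at f (path_elem d))"
  shows "equiv_class i1 i2 f d p = equiv_class i1 i2 f d q"
proof -
  let ?J = "left_principal (poly_at f (path_elem d) :: ('a, 'b) lpa)"
  have J: "left_ideal ?J" by (rule left_ideal_principal)
  have "equiv_fd f d x y \<longleftrightarrow> x - y \<in> ?J" for x y
    by (simp add: equiv_fd_def left_principal_def)
  moreover have "p - x \<in> ?J \<longleftrightarrow> q - x \<in> ?J" for x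
    using left_ideal_cong_trans[OF J assms, of x]
      left_ideal_cong_trans[OF J left_ideal_cong_sym[OF J assms], of x] by blast
  ultimately show ?thesis by (simp add: equiv_class_def)
qed

text \<open>The inequality of classes enters the proof in the form that \<open>p\<close> is outside
  the left ideal.\<close>

lemma twisted_indexD:
  assumes "(f, d, p) \<in> twisted_index i1 i2"
  shows "f \<in> Irr_poly" "d \<in> C_s i2" "d \<in> SCP" "last d = i2" "p \<in> A_subalg i1 i2"
    "p \<notin> left_principal (poly_at f (path_elem d))"
proof -
  show *: "f \<in> Irr_poly" "d \<in> C_s i2" "p \<in> A_subalg i1 i2"
    using assms by (auto simp: twisted_index_def)
  then show "d \<in> SCP" "last d = i2" by (auto simp: C_s_def)
  show "p \<notin> left_principal (poly_at f (path_elem d))"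
    using equiv_class_eqI[of p 0 f d i1 i2] assms by (auto simp: twisted_index_def)
qed

lemma simple_S:
  assumes "f \<in> Irr_poly" "c \<in> SCP"
  shows "simple_module (S_module f c)"
proof -
  interpret simple_cycle f c using assms by unfold_locales
  show ?thesis using simple_quot_J by (simp add: S_module_def J_def P_def)
qed

lemma one_notin_principal:
  "f \<in> Irr_poly \<Longrightarrow> c \<in> SCP \<Longrightarrow> 1 \<notin> left_principal (poly_at f (path_elem c))"
  by (simp add: one_notin_principal_poly SCP_not_Nil)

lemma S_iso_S:
  fixes f g :: "'k::field poly" and c d :: "'n::finite list"
  assumes "f \<in> Irr_poly" "c \<in> SCP" "g \<in> Irr_poly" "d \<in> SCP"
    and iso: "(S_module f c :: (('k, 'n) lpa, _) lmod) \<cong>\<^sub>m S_module g d"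
  shows "f = g \<and> rotations c = rotations d"
proof -
  obtain b where "b \<notin> left_principal (poly_at g (path_elem d) :: ('k, 'n) lpa)"
    "\<And>s. s \<in> left_principal (poly_at f (path_elem c)) \<Longrightarrow>
      s * b \<in> left_principal (poly_at g (path_elem d))"
    using quot_iso_annihilator[OF left_ideal_principal one_notin_principal left_ideal_principal
        lpa_hom_id lpa_hom_id, unfolded twist_id] assms unfolding S_module_def by blast
  from simple_cycle_annihilated[OF assms(3,4,1,2) this] show ?thesis by blast
qed

lemma V_iso_S:
  fixes f :: "'k::field poly" and c :: "'n::finite list"
  assumes "f \<in> Irr_poly" "c \<in> SCP"
    and iso: "(V_module (tail_class \<alpha>) :: (('k, 'n) lpa, _) lmod) \<cong>\<^sub>m S_module f c"
  shows "tail_equiv \<alpha> (cycle c)"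
proof -
  interpret simple_cycle f c using assms by unfold_locales
  have "V_module (tail_class \<alpha>) \<cong>\<^sub>m twist (\<lambda>r. r) (quot_module J)"
    using iso by (simp add: twist_id S_module_def J_def P_def)
  then obtain b where "b \<notin> J" "\<And>k. (1 - path_elem (stake k \<alpha>) * ghost_path (stake k \<alpha>)) * b \<in> J"
    using V_iso_quot[OF lpa_hom_id left_ideal_J] by metis
  then show ?thesis by (rule concentrated_tail_equiv)
qed

context petal_pair
begin

lemma simple_T:
  assumes "(f, d, p) \<in> twisted_index i1 i2"
  shows "simple_module (S_twisted i1 i2 f p d)"
  unfolding S_twisted_def
  using twisted_indexD[OF assms] by (intro simple_twist lpa_hom_sigma surj_sigma simple_S)

lemma V_not_iso_T:
  fixes f :: "'k::field poly" and p :: "('k, 'n) lpa"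
  assumes "(f, d, p) \<in> twisted_index i1 i2"
  shows "\<not> V_module (tail_class \<alpha>) \<cong>\<^sub>m S_twisted i1 i2 f p d"
proof
  note D = twisted_indexD[OF assms]
  assume "V_module (tail_class \<alpha>) \<cong>\<^sub>m S_twisted i1 i2 f p d"
  then obtain b where "b \<notin> left_principal (poly_at f (path_elem d))"
    "\<And>k. sigma i1 i2 p (1 - path_elem (stake k \<alpha>) * ghost_path (stake k \<alpha>)) * b \<in>
      left_principal (poly_at f (path_elem d))"
    unfolding S_twisted_def S_module_def
    using V_iso_quot[OF lpa_hom_sigma[OF D(5)] left_ideal_principal] by metis
  from twisted_concentrated[OF D(1,3,4,5) this] D(6) show False by blast
qed

text \<open>By \<open>concentrated_generator\<close> the ideal of \<open>g(c)\<close> contains the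
  elements that express concentration on \<open>cycle c\<close>, so \<open>b\<close> is concentrated
  on that path for the twisted action.\<close>

lemma annihilated_twisted:
  fixes f :: "'k::field poly" and p :: "('k, 'n) lpa"
  assumes f: "f \<in> Irr_poly" "d \<in> C_s i2" and g: "g \<in> Irr_poly" "c \<in> SCP"
    and p: "p \<in> A_subalg i1 i2"
    and b: "b \<notin> left_principal (poly_at f (path_elem d))"
    and ann: "\<And>s. s \<in> left_principal (poly_at g (path_elem c)) \<Longrightarrow>
      sigma i1 i2 p s * b \<in> left_principal (poly_at f (path_elem d))"
  shows "p \<in> left_principal (poly_at f (path_elem d))"
proof -
  interpret C: simple_cycle g c using g by unfold_locales
  have "1 - path_elem (stake k (cycle c)) * ghost_path (stake k (cycle c)) \<in>
      left_principal (poly_at g (path_elem c) :: ('k, 'n) lpa)" for k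
    using C.concentrated_generator by (simp add: C.J_def C.P_def)
  from twisted_concentrated[OF f(1) _ _ p b ann[OF this]] f(2) show ?thesis
    by (simp add: C_s_def)
qed

lemma S_not_iso_T:
  fixes f :: "'k::field poly" and p :: "('k, 'n) lpa"
  assumes "(f, d, p) \<in> twisted_index i1 i2" and g: "g \<in> Irr_poly" "c \<in> SCP"
  shows "\<not> S_module g c \<cong>\<^sub>m S_twisted i1 i2 f p d"
proof
  note D = twisted_indexD[OF assms(1)]
  assume "S_module g c \<cong>\<^sub>m S_twisted i1 i2 f p d"
  then obtain b where "b \<notin> left_principal (poly_at f (path_elem d))"
    "\<And>s. s \<in> left_principal (poly_at g (path_elem c)) \<Longrightarrow>
      sigma i1 i2 p s * b \<in> left_principal (poly_at f (path_elem d))"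
    unfolding S_twisted_def S_module_def
    using quot_iso_annihilator[OF left_ideal_principal one_notin_principal[OF g]
        left_ideal_principal lpa_hom_id lpa_hom_sigma[OF D(5)], unfolded twist_id] by blast
  from annihilated_twisted[OF D(1,2) g D(5) this] D(6) show False by blast
qed

text \<open>Composing with the automorphism for \<open>- p\<close> leaves a single twist, by
  \<open>q - p\<close>, and \<open>annihilated_twisted\<close> puts \<open>q - p\<close> into the
  ideal of \<open>g(c)\<close>. Undoing this twist reduces the comparison to untwisted
  modules.\<close>

lemma T_iso_T:
  fixes f g :: "'k::field poly" and p q :: "('k, 'n) lpa"
  assumes "(f, d, p) \<in> twisted_index i1 i2" "(g, c, q) \<in> twisted_index i1 i2"
    and iso: "S_twisted i1 i2 f p d \<cong>\<^sub>m S_twisted i1 i2 g q c"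
  shows "f = g \<and> d = c \<and> equiv_class i1 i2 f d p = equiv_class i1 i2 g c q"
proof -
  note D = twisted_indexD[OF assms(1)] and C = twisted_indexD[OF assms(2)]
  let ?I = "left_principal (poly_at f (path_elem d) :: ('k, 'n) lpa)"
  let ?J = "left_principal (poly_at g (path_elem c) :: ('k, 'n) lpa)"
  let ?e = "q - p"
  have e: "?e \<in> A_subalg i1 i2" using C(5) D(5) by (rule A_subalg_diff)
  obtain b where b: "b \<notin> ?J" "\<And>r. sigma i1 i2 p r \<in> ?I \<Longrightarrow> sigma i1 i2 q r * b \<in> ?J"
    using quot_iso_annihilator[OF left_ideal_principal one_notin_principal[OF D(1,3)]
        left_ideal_principal lpa_hom_sigma[OF D(5)] lpa_hom_sigma[OF C(5)]] iso
    unfolding S_twisted_def S_module_def by blast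
  have ann: "sigma i1 i2 ?e s * b \<in> ?J" if "s \<in> ?I" for s
    using b(2)[of "sigma i1 i2 (- p) s"] that
    by (simp add: sigma_uminus[OF D(5)] sigma_comp[OF C(5) A_subalg_uminus[OF D(5)]])
  have eJ: "?e \<in> ?J" by (rule annihilated_twisted[OF C(1,2) D(1,3) e b(1) ann])
  have eJ': "- ?e \<in> ?J" by (rule left_ideal_uminus[OF left_ideal_principal eJ])
  \<comment> \<open>The automorphisms for \<open>q - p\<close> and its negative both map the ideal
    of \<open>g(c)\<close> into itself. So \<open>b'\<close> is still outside it, and is annihilated
    modulo it by the ideal of \<open>f(d)\<close> without any twist.\<close>
  define b' where "b' = sigma i1 i2 (- ?e) b"
  have "b' \<notin> ?J"
    using sigma_ideal_subset[OF C(1,2) e eJ, of b'] b(1) sigma_uminus(1)[OF e, of b]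
    unfolding b'_def by metis
  moreover have "s * b' \<in> ?J" if "s \<in> ?I" for s
  proof -
    have "sigma i1 i2 (- ?e) (sigma i1 i2 ?e s * b) \<in> ?J"
      by (rule sigma_ideal_subset[OF C(1,2) A_subalg_uminus[OF e] eJ' ann[OF that]])
    then show ?thesis
      by (simp only: lpa_homD(2)[OF lpa_hom_sigma[OF A_subalg_uminus[OF e]]] sigma_uminus[OF e] b'_def)
  qed
  ultimately have "f = g \<and> rotations d = rotations c"
    by (rule simple_cycle_annihilated[OF C(1,3) D(1,3)])
  then have fg: "f = g" "d = c" using C_s_rotations_inj[OF D(2) C(2)] by auto
  have "p - q \<in> ?J" using eJ' by simp
  with fg show ?thesis using equiv_class_eqI[of p q g c i1 i2] by simp
qed

end

theorem theorem3p8: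
  fixes i1 i2 :: "'n::finite"
  assumes "2 \<le> CARD('n)" and "i1 \<noteq> i2"
  defines "V \<equiv> (V_module :: 'n stream set \<Rightarrow> (('k::field, 'n) lpa, 'n stream \<Rightarrow>\<^sub>0 'k) lmod)"
    and "S \<equiv> (S_module :: 'k poly \<Rightarrow> 'n list \<Rightarrow> (('k, 'n) lpa, ('k, 'n) lpa set) lmod)"
    and "T \<equiv> (S_twisted i1 i2 :: 'k poly \<Rightarrow> ('k, 'n) lpa \<Rightarrow> 'n list \<Rightarrow>
                (('k, 'n) lpa, ('k, 'n) lpa set) lmod)"
  shows
    "(\<forall>\<alpha>\<in>irrational_paths. simple_module (V (tail_class \<alpha>))) \<and>
     (\<forall>f\<in>Irr_poly. \<forall>c\<in>SCP. simple_module (S f c)) \<and>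
     (\<forall>(f, d, p)\<in>twisted_index i1 i2. simple_module (T f p d)) \<and>
     (\<forall>\<alpha>\<in>irrational_paths. \<forall>\<beta>\<in>irrational_paths.
        tail_class \<alpha> \<noteq> tail_class \<beta> \<longrightarrow> \<not> V (tail_class \<alpha>) \<cong>\<^sub>m V (tail_class \<beta>)) \<and>
     (\<forall>f\<in>Irr_poly. \<forall>g\<in>Irr_poly. \<forall>c\<in>SCP. \<forall>d\<in>SCP.
        (f, rotations c) \<noteq> (g, rotations d) \<longrightarrow> \<not> S f c \<cong>\<^sub>m S g d) \<and>
     (\<forall>(f, d, p)\<in>twisted_index i1 i2. \<forall>(g, d', q)\<in>twisted_index i1 i2.
        (f, d, equiv_class i1 i2 f d p) \<noteq> (g, d', equiv_class i1 i2 g d' q) \<longrightarrow>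
        \<not> T f p d \<cong>\<^sub>m T g q d') \<and>
     (\<forall>\<alpha>\<in>irrational_paths. \<forall>f\<in>Irr_poly. \<forall>c\<in>SCP. \<not> V (tail_class \<alpha>) \<cong>\<^sub>m S f c) \<and>
     (\<forall>\<alpha>\<in>irrational_paths. \<forall>(f, d, p)\<in>twisted_index i1 i2.
        \<not> V (tail_class \<alpha>) \<cong>\<^sub>m T f p d) \<and>
     (\<forall>g\<in>Irr_poly. \<forall>c\<in>SCP. \<forall>(f, d, p)\<in>twisted_index i1 i2. \<not> S g c \<cong>\<^sub>m T f p d)"
proof -
  interpret petal_pair i1 i2 using assms(2) by unfold_locales
  have irr: "\<not> tail_equiv \<alpha> (cycle c)" if "\<alpha> \<in> irrational_paths" "c \<in> SCP" for \<alpha> :: "'n stream" and c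
    using that by (auto simp: irrational_paths_def dest: SCP_not_Nil)
  show ?thesis
    unfolding V_def S_def T_def
    by (auto simp: simple_V simple_S simple_T V_not_iso_T S_not_iso_T irr
        dest: V_iso_V S_iso_S[rotated 4] T_iso_T[rotated 2] V_iso_S[rotated 2])
qed

end
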